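(* Let $G$ be a planar ribbon graph such that both $G$ and its planar dual $G^*$ are loopless, and let $G^*$ carry the planar dual ribbon structure. Let $\phi\colon \mathrm{Jac}(G)\to\mathrm{Jac}(G^* )$ be the duality isomorphism and $\delta\colon\mathcal{T}(G)\to\mathcal{T}(G^* )$ the duality bijection on spanning trees (both defined in the context). Then for every $[D]\in\mathrm{Jac}(G)$ and every spanning tree $T\in\mathcal{T}(G)$, \[\delta([D]\cdot T)=\phi([D])\cdot \delta(T),\] where on the left $\cdot$ is the rotor-routing action of $\mathrm{Jac}(G)$ on $\mathcal{T}(G)$ and on the right it is the rotor-routing action of $\mathrm{Jac}(G^* )$ on $\mathcal{T}(G^* )$ (each computed with respect to any basepoint). In other words, the square formed by $\mu_G\colon\mathrm{Jac}(G)\times\mathcal{T}(G)\to\mathcal{T}(G)$, $\mu_{G^*}$, $\phi\times\delta$ and $\delta$ commutes.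
   Context: Graphs are finite connected loopless multigraphs $G=(V,E)$. Divisors are elements of $\mathbb{Z}V$; $\mathrm{Div}^0(G)$ is the subgroup of divisors with total degree $0$. A lending move at $v$ subtracts $\deg(v)$ from the coefficient of $v$ and adds $n(v,w)$ (the number of edges between $v$ and $w$) to the coefficient of each $w\neq v$. Two divisors are linearly equivalent if related by a sequence of lending moves; the sandpile group is $\mathrm{Jac}(G)=\mathrm{Div}^0(G)/\!\sim$. For a directed edge $e$ with tail $e^-$ and head $e^+$ write $\partial e=[e^+-e^-]\in\mathrm{Jac}(G)$. A ribbon graph structure is a choice, at every vertex, of a cyclic ordering of the incident edges. Rotor-routing with basepoint $q$: a rotor configuration assigns to each $v\neq q$ an incident edge $\rho(v)$. Firing $v$ replaces $\rho(v)$ by the next edge in the cyclic order at $v$ and moves one chip from $v$ to the other endpoint of the new $\rho(v)$. A spanning tree $T$ gives the rotor configuration $\rho_T$ where $\rho_T(v)$ is the first edge of the path in $T$ from $v$ to $q$. Given $[D]\in\mathrm{Jac}(G)$, choose a representative with nonnegative coefficients at all vertices other than $q$ and fire vertices $\neq q$ carrying chips until all chips are at $q$ (hence gone); the final rotor configuration is $\rho_{T'}$ for a spanning tree $T'$, and one sets $[D]\cdot T=T'$. By Holroyd et al. this is well defined and is a simply transitive action of $\mathrm{Jac}(G)$ on the set $\mathcal{T}(G)$ of spanning trees; by Chan–Church–Grochow, for planar ribbon graphs it does not depend on the basepoint $q$. Planar duality: $G$ is a planar ribbon graph, i.e. its cyclic orders come from an embedding of $G$ in the plane, and the orientation of the plane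 agreeing with the cyclic orders is called clockwise. $G$ has no bridges or loops, so $G^*$ (vertices = faces of $G$, an edge $e^*$ crossing each edge $e$ of $G$) is loopless. The ribbon structure on $G^*$ uses the counterclockwise cyclic orders. Fix an orientation of each edge of $G$; for an oriented edge $e$ with tail $v$, let $e'$, $e''$ be the edges before and after $e$ in the cyclic order at $v$; the face between $e'$ and $e$ is "before $e$" and the face between $e$ and $e''$ is "after $e$"; orient $e^*$ with head the face before $e$ and tail the face after $e$. Let $\mathcal{C},\mathcal{C}^*\subseteq\mathbb{Z}E$ be the integer spans of directed cycles and of cuts, and $\mathcal{E}(G)=\mathbb{Z}E/(\mathcal{C}+\mathcal{C}^* )$; the map $e\mapsto \partial e$ induces an isomorphism $\mathcal{E}(G)\cong\mathrm{Jac}(G)$, and $e\mapsto e^*$ induces an isomorphism $\mathcal{E}(G)\cong\mathcal{E}(G^* )$. The composite isomorphism $\phi\colon\mathrm{Jac}(G)\to\mathrm{Jac}(G^* )$ is characterized by $\phi(\partial_G e)=\partial_{G^*}(e^* )$ for each oriented edge $e$. The bijection $\delta$ sends $T$ to $T^*=\{e^*: e\in E\setminus T\}$. *)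

theory Defs
  imports
    "Graph_Theory.Graph_Theory"
    "HOL-Algebra.Free_Abelian_Groups"
    "HOL-Combinatorics.Orbits"
begin

section \<open>Divisors and the sandpile group\<close>

text \<open>
  A multigraph is a digraph in which every edge occurs as two opposite arcs, exchanged by a
  fixed-point-free involution; so arcs are oriented edges, and \<open>out_arcs G v\<close> are the edges
  incident to \<open>v\<close>, oriented away from \<open>v\<close>.
\<close>

definition divisor_degree :: "('a \<Rightarrow>\<^sub>0 int) \<Rightarrow> int" where
  "divisor_degree D = (\<Sum>v\<in>Poly_Mapping.keys D. Poly_Mapping.lookup D v)"

definition Div0 :: "('a, 'b) pre_digraph \<Rightarrow> ('a \<Rightarrow>\<^sub>0 int) monoid" where
  "Div0 G = (free_Abelian_group (verts G))
     \<lparr>carrier := {D \<in> carrier (free_Abelian_group (verts G)). divisor_degree D = 0}\<rparr>"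

definition lending :: "('a, 'b) pre_digraph \<Rightarrow> 'a \<Rightarrow> ('a \<Rightarrow>\<^sub>0 int)" where
  "lending G v = (\<Sum>a\<in>out_arcs G v. frag_of (head G a)) - frag_cmul (int (out_degree G v)) (frag_of v)"

text \<open>
  Lending once at every vertex changes nothing, so sequences of lending moves already
  realise the whole subgroup that they generate.
\<close>

definition principal_divisors :: "('a, 'b) pre_digraph \<Rightarrow> ('a \<Rightarrow>\<^sub>0 int) set" where
  "principal_divisors G = generate (Div0 G) (lending G ` verts G)"

definition Jac :: "('a, 'b) pre_digraph \<Rightarrow> ('a \<Rightarrow>\<^sub>0 int) set monoid" where
  "Jac G = Div0 G Mod principal_divisors G"

definition divisor_class :: "('a, 'b) pre_digraph \<Rightarrow> ('a \<Rightarrow>\<^sub>0 int) \<Rightarrow> ('a \<Rightarrow>\<^sub>0 int) set" where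
  "divisor_class G D = principal_divisors G #>\<^bsub>Div0 G\<^esub> D"


section \<open>Spanning trees\<close>

text \<open>
  A set of edges is given by the set of all arcs underlying it, a set closed under \<open>rv\<close>.
  In the acyclicity condition, \<^const>\<open>pre_digraph.cycle\<close> also holds of the closed walk \<open>[a, rv a]\<close>,
  which is not a cycle of the undirected graph.
\<close>

definition spanning_trees :: "('a, 'b) pre_digraph \<Rightarrow> ('b \<Rightarrow> 'b) \<Rightarrow> 'b set set" where
  "spanning_trees G rv = {T. T \<subseteq> arcs G \<and> rv ` T = T \<and> connected (G\<lparr>arcs := T\<rparr>) \<and>
     (\<nexists>p. pre_digraph.cycle (G\<lparr>arcs := T\<rparr>) p \<and> (\<forall>a\<in>set p. rv a \<notin> set p))}"


section \<open>Rotor-routing\<close>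

text \<open>
  Throughout, \<open>\<sigma>\<close> maps an arc to the next arc in the cyclic order at its tail.
  A rotor configuration is only meaningful on the vertices other than the basepoint \<open>q\<close>.
\<close>

inductive fire :: "('a, 'b) pre_digraph \<Rightarrow> ('b \<Rightarrow> 'b) \<Rightarrow> 'a \<Rightarrow>
    ('a \<Rightarrow>\<^sub>0 int) \<times> ('a \<Rightarrow> 'b) \<Rightarrow> ('a \<Rightarrow>\<^sub>0 int) \<times> ('a \<Rightarrow> 'b) \<Rightarrow> bool"
  for G \<sigma> q where
  "\<lbrakk>v \<in> verts G; v \<noteq> q; Poly_Mapping.lookup D v > 0\<rbrakk> \<Longrightarrow>
     fire G \<sigma> q (D, \<rho>) (D - frag_of v + frag_of (head G (\<sigma> (\<rho> v))), \<rho>(v := \<sigma> (\<rho> v)))"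

definition tree_rotor :: "('a, 'b) pre_digraph \<Rightarrow> 'a \<Rightarrow> 'b set \<Rightarrow> 'a \<Rightarrow> 'b" where
  "tree_rotor G q T v = hd (THE p. pre_digraph.apath (G\<lparr>arcs := T\<rparr>) v p q)"

definition routes_to :: "('a, 'b) pre_digraph \<Rightarrow> ('b \<Rightarrow> 'b) \<Rightarrow> 'a \<Rightarrow>
    ('a \<Rightarrow>\<^sub>0 int) \<Rightarrow> 'b set \<Rightarrow> 'b set \<Rightarrow> bool" where
  "routes_to G \<sigma> q D T T' \<longleftrightarrow> (\<exists>D' \<rho>'. (fire G \<sigma> q)\<^sup>*\<^sup>* (D, tree_rotor G q T) (D', \<rho>') \<and>
     (\<forall>v\<in>verts G - {q}. Poly_Mapping.lookup D' v = 0 \<and> \<rho>' v = tree_rotor G q T' v))"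

definition rotor_action :: "('a, 'b) pre_digraph \<Rightarrow> ('b \<Rightarrow> 'b) \<Rightarrow> ('b \<Rightarrow> 'b) \<Rightarrow> 'a \<Rightarrow>
    ('a \<Rightarrow>\<^sub>0 int) set \<Rightarrow> 'b set \<Rightarrow> 'b set" where
  "rotor_action G rv \<sigma> q x T = (THE T'. T' \<in> spanning_trees G rv \<and>
     (\<exists>D\<in>x. (\<forall>v\<in>verts G - {q}. 0 \<le> Poly_Mapping.lookup D v) \<and> routes_to G \<sigma> q D T T'))"


section \<open>Planar ribbon graphs and duality\<close>

locale ribbon_graph = fin_digraph G + bidirected_digraph G rv
  for G :: "('a, 'b) pre_digraph" and rv :: "'b \<Rightarrow> 'b" +
  fixes \<sigma> :: "'b \<Rightarrow> 'b"
  assumes connected_graph: "connected G"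
    and succ_permutes: "\<sigma> permutes arcs G"
    and succ_cyclic: "\<lbrakk>v \<in> verts G; out_arcs G v \<noteq> {}\<rbrakk> \<Longrightarrow> cyclic_on \<sigma> (out_arcs G v)"

text \<open>
  The corner between two arcs \<open>a'\<close> and \<open>a = \<sigma> a'\<close> at a vertex is identified with \<open>a\<close>. With \<open>\<sigma>\<close>
  clockwise, this corner is on the left of \<open>a\<close>, and the next corner met when walking along \<open>a\<close>
  with the face on the left is the one between \<open>rv a\<close> and \<open>\<sigma> (rv a)\<close>. Hence the face before
  \<open>a\<close> is the orbit of \<open>a\<close> under \<open>\<sigma> \<circ> rv\<close>.
\<close>

definition face_before :: "('b \<Rightarrow> 'b) \<Rightarrow> ('b \<Rightarrow> 'b) \<Rightarrow> 'b \<Rightarrow> 'b set" where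
  "face_before rv \<sigma> a = orbit (\<sigma> \<circ> rv) a"

definition face_after :: "('b \<Rightarrow> 'b) \<Rightarrow> ('b \<Rightarrow> 'b) \<Rightarrow> 'b \<Rightarrow> 'b set" where
  "face_after rv \<sigma> a = face_before rv \<sigma> (\<sigma> a)"

text \<open>A connected graph without edges is a single vertex, whose only face has no corners.\<close>

definition faces :: "('a, 'b) pre_digraph \<Rightarrow> ('b \<Rightarrow> 'b) \<Rightarrow> ('b \<Rightarrow> 'b) \<Rightarrow> 'b set set" where
  "faces G rv \<sigma> = (if arcs G = {} then {{}} else face_before rv \<sigma> ` arcs G)"

definition edges :: "('a, 'b) pre_digraph \<Rightarrow> ('b \<Rightarrow> 'b) \<Rightarrow> 'b set set" where
  "edges G rv = (\<lambda>a. {a, rv a}) ` arcs G"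

text \<open>
  The cyclic orders of a connected ribbon graph come from an embedding in the plane iff the closed
  oriented surface obtained by gluing a disc to each face of the ribbon graph is a sphere, that is,
  has Euler characteristic 2.
\<close>

locale planar_ribbon_graph = ribbon_graph +
  assumes euler_sphere:
    "int (card (verts G)) - int (card (edges G rv)) + int (card (faces G rv \<sigma>)) = 2"

text \<open>
  The arc \<open>a\<close> of \<open>G\<close> also names the dual arc, from the face after \<open>a\<close> to the face before \<open>a\<close>.
  Then \<open>rv a\<close> names the reverse of the dual of \<open>a\<close>.
\<close>

definition dual :: "('a, 'b) pre_digraph \<Rightarrow> ('b \<Rightarrow> 'b) \<Rightarrow> ('b \<Rightarrow> 'b) \<Rightarrow> ('b set, 'b) pre_digraph" where
  "dual G rv \<sigma> = \<lparr>verts = faces G rv \<sigma>, arcs = arcs G,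
     tail = face_after rv \<sigma>, head = face_before rv \<sigma>\<rparr>"

text \<open>
  The dual arc of \<open>a\<close> leaves its face \<open>f\<close> across \<open>a\<close>. The next edge on the boundary of \<open>f\<close>, in the
  counterclockwise sense as seen from \<open>f\<close>, is that of \<open>\<sigma> a\<close>, which has \<open>f\<close> on its left, and
  the dual of \<open>rv (\<sigma> a)\<close> leaves \<open>f\<close> across this edge.
\<close>

definition dual_succ :: "('b \<Rightarrow> 'b) \<Rightarrow> ('b \<Rightarrow> 'b) \<Rightarrow> 'b \<Rightarrow> 'b" where
  "dual_succ rv \<sigma> = rv \<circ> \<sigma>"

definition dual_tree :: "('a, 'b) pre_digraph \<Rightarrow> 'b set \<Rightarrow> 'b set" where
  "dual_tree G T = arcs G - T"


section \<open>The duality isomorphism of sandpile groups\<close>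

text \<open>The set \<open>\<omega>\<close> contains exactly one of the two arcs of each edge.\<close>

definition orientation :: "('a, 'b) pre_digraph \<Rightarrow> ('b \<Rightarrow> 'b) \<Rightarrow> 'b set \<Rightarrow> bool" where
  "orientation G rv \<omega> \<longleftrightarrow> \<omega> \<subseteq> arcs G \<and> (\<forall>a\<in>arcs G. a \<in> \<omega> \<longleftrightarrow> rv a \<notin> \<omega>)"

definition chain_of_arc :: "('b \<Rightarrow> 'b) \<Rightarrow> 'b set \<Rightarrow> 'b \<Rightarrow> ('b \<Rightarrow>\<^sub>0 int)" where
  "chain_of_arc rv \<omega> a = (if a \<in> \<omega> then frag_of a else - frag_of (rv a))"

text \<open>The degenerate walks \<open>[a, rv a]\<close> contribute only the zero chain.\<close>

definition cycle_lattice :: "('a, 'b) pre_digraph \<Rightarrow> ('b \<Rightarrow> 'b) \<Rightarrow> 'b set \<Rightarrow> ('b \<Rightarrow>\<^sub>0 int) set" where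
  "cycle_lattice G rv \<omega> = generate (free_Abelian_group \<omega>)
     {(\<Sum>a\<in>set p. chain_of_arc rv \<omega> a) |p. pre_digraph.cycle G p}"

definition cut_lattice :: "('a, 'b) pre_digraph \<Rightarrow> ('b \<Rightarrow> 'b) \<Rightarrow> 'b set \<Rightarrow> ('b \<Rightarrow>\<^sub>0 int) set" where
  "cut_lattice G rv \<omega> = generate (free_Abelian_group \<omega>)
     {(\<Sum>a\<in>{a \<in> arcs G. tail G a \<in> U \<and> head G a \<notin> U}. chain_of_arc rv \<omega> a) |U. U \<subseteq> verts G}"

definition cycles_cuts :: "('a, 'b) pre_digraph \<Rightarrow> ('b \<Rightarrow> 'b) \<Rightarrow> 'b set \<Rightarrow> ('b \<Rightarrow>\<^sub>0 int) set" where
  "cycles_cuts G rv \<omega> = cycle_lattice G rv \<omega> <#>\<^bsub>free_Abelian_group \<omega>\<^esub> cut_lattice G rv \<omega>"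

definition edge_group :: "('a, 'b) pre_digraph \<Rightarrow> ('b \<Rightarrow> 'b) \<Rightarrow> 'b set \<Rightarrow> ('b \<Rightarrow>\<^sub>0 int) set monoid" where
  "edge_group G rv \<omega> = free_Abelian_group \<omega> Mod cycles_cuts G rv \<omega>"

definition boundary :: "('a, 'b) pre_digraph \<Rightarrow> ('b \<Rightarrow>\<^sub>0 int) \<Rightarrow> ('a \<Rightarrow>\<^sub>0 int)" where
  "boundary G = frag_extend (\<lambda>a. frag_of (head G a) - frag_of (tail G a))"

text \<open>
  A homomorphism out of a quotient group is given on a coset by the common value of a homomorphism
  at its elements.
\<close>

definition edge_group_to_Jac :: "('a, 'b) pre_digraph \<Rightarrow> ('b \<Rightarrow>\<^sub>0 int) set \<Rightarrow> ('a \<Rightarrow>\<^sub>0 int) set" where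
  "edge_group_to_Jac G X = the_elem ((\<lambda>c. divisor_class G (boundary G c)) ` X)"

text \<open>Since the dual arc of \<open>a\<close> has the same name, the underlying map on chains is the identity.\<close>

definition edge_group_to_dual ::
    "('a, 'b) pre_digraph \<Rightarrow> ('b \<Rightarrow> 'b) \<Rightarrow> ('b \<Rightarrow> 'b) \<Rightarrow> 'b set \<Rightarrow> ('b \<Rightarrow>\<^sub>0 int) set \<Rightarrow> ('b \<Rightarrow>\<^sub>0 int) set" where
  "edge_group_to_dual G rv \<sigma> \<omega> X =
     the_elem ((\<lambda>c. cycles_cuts (dual G rv \<sigma>) rv \<omega> #>\<^bsub>free_Abelian_group \<omega>\<^esub> c) ` X)"

definition duality_iso ::
    "('a, 'b) pre_digraph \<Rightarrow> ('b \<Rightarrow> 'b) \<Rightarrow> ('b \<Rightarrow> 'b) \<Rightarrow> 'b set \<Rightarrow> ('a \<Rightarrow>\<^sub>0 int) set \<Rightarrow> ('b set \<Rightarrow>\<^sub>0 int) set" where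
  "duality_iso G rv \<sigma> \<omega> = edge_group_to_Jac (dual G rv \<sigma>) \<circ> edge_group_to_dual G rv \<sigma> \<omega>
     \<circ> inv_into (carrier (edge_group G rv \<omega>)) (edge_group_to_Jac G)"

end

theory Submission
  imports Defs
begin

text \<open>
  Fix basepoints \<open>q\<close> and \<open>q'\<close> of \<open>G\<close> and its dual \<open>G*\<close>. A spanning tree \<open>T\<close> determines an orientation
  \<open>\<omega>\<^sub>T\<close> of all edges: those of \<open>T\<close> point towards \<open>q\<close>, those of the dual tree towards \<open>q'\<close>. Let
  \<open>w = \<omega>\<^sub>T\<^sub>' - \<omega>\<^sub>T\<close> as a flow on the arcs. The chips that are routed while \<open>T\<close> turns into
  \<open>T' = [D] \<sqdot> T\<close> traverse a flow \<open>z\<close> whose divergence in \<open>G\<close> is \<open>D\<close>. In \<open>G*\<close>, a rotor step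
  carries the face after the old rotor to the face after the new one, so that \<open>z\<close> and \<open>w\<close> have the
  same divergence in \<open>G*\<close>; hence they differ by a cycle of \<open>G*\<close>, which is a cut of \<open>G\<close>, and
  \<open>[D]\<close> is the class of the divergence of \<open>w\<close> in \<open>G\<close>. This description of the action is
  symmetric in \<open>G\<close> and \<open>G*\<close>, and the duality isomorphism maps the divergence class of \<open>w\<close> in
  \<open>G\<close> to that in \<open>G*\<close>.

  The class determines \<open>T'\<close>: if the divergence of \<open>w\<close> is principal, then \<open>w\<close> is the sum of a cut and
  a cycle, which are orthogonal, and since \<open>w\<close> has values in \<open>{-1, 0, 1}\<close> both vanish. So
  \<open>\<omega>\<^sub>T = \<omega>\<^sub>T\<^sub>'\<close>. As the divergence of \<open>w\<close> in \<open>G\<close> does not depend on \<open>q\<close>, this holds for all \<open>q\<close>,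
  and an edge belongs to \<open>T\<close> iff its orientation in \<open>\<omega>\<^sub>T\<close> depends on \<open>q\<close>.
\<close>

section \<open>Spanning trees as rotor configurations\<close>

abbreviation lookup :: "('a \<Rightarrow>\<^sub>0 int) \<Rightarrow> 'a \<Rightarrow> int" where
  "lookup \<equiv> Poly_Mapping.lookup"

abbreviation keys :: "('a \<Rightarrow>\<^sub>0 int) \<Rightarrow> 'a set" where
  "keys \<equiv> Poly_Mapping.keys"

text \<open>The set of vertices reachable from \<open>u\<close> is closed under following arcs,
  hence is everything. Only well-formedness is assumed, so the criterion applies to the dual graph
  before that graph is shown to be bidirected.\<close>

lemma (in wf_digraph) connectedI_closed:
  assumes "verts G \<noteq> {}"
    and closed: "\<And>U. U \<subseteq> verts G \<Longrightarrow> U \<noteq> {} \<Longrightarrow>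
      (\<And>a. a \<in> arcs G \<Longrightarrow> tail G a \<in> U \<Longrightarrow> head G a \<in> U) \<Longrightarrow> U = verts G"
  shows "connected G"
proof (rule connectedI[OF assms(1)])
  fix u v assume u: "u \<in> verts G" and v: "v \<in> verts G"
  define U where "U = {w. u \<rightarrow>\<^sup>* w}"
  have "U = verts G"
  proof (rule closed)
    show "U \<subseteq> verts G" unfolding U_def using reachable_in_verts(2) by fastforce
    show "U \<noteq> {}" using u reachable_refl unfolding U_def by fastforce
    fix a assume a: "a \<in> arcs G" "tail G a \<in> U"
    then have "tail G a \<rightarrow> head G a"
      unfolding arcs_ends_conv by auto
    then show "head G a \<in> U" using a(2) reachable_adj_trans unfolding U_def by blast
  qed
  then show "u \<rightarrow>\<^sup>*\<^bsub>mk_symmetric G\<^esub> v"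
    using v reachable_mk_symmetricI unfolding U_def by blast
qed

text \<open>Home of everything that involves no cyclic order. A ribbon graph and its dual are both
  instances, so all of it is available on both sides of the duality.\<close>

locale connected_multigraph = fin_digraph G + bidirected_digraph G rv
  for G :: "('a, 'b) pre_digraph" and rv :: "'b \<Rightarrow> 'b" +
  assumes connected_graph: "connected G"

sublocale ribbon_graph \<subseteq> connected_multigraph
  by unfold_locales (rule connected_graph)

context connected_multigraph
begin

section \<open>Walks and connectivity in spanning subgraphs\<close>

abbreviation spanning_subgraph :: "'b set \<Rightarrow> ('a, 'b) pre_digraph" where
  "spanning_subgraph S \<equiv> G\<lparr>arcs := S\<rparr>"

lemma verts_nonempty: "verts G \<noteq> {}"
  using connected_graph unfolding connected_conv by blast

lemma wf_spanning_subgraph: "S \<subseteq> arcs G \<Longrightarrow> wf_digraph (spanning_subgraph S)"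
  by unfold_locales auto

lemma symmetric_spanning_subgraph:
  assumes "S \<subseteq> arcs G" "rv ` S = S"
  shows "symmetric (spanning_subgraph S)"
  unfolding symmetric_conv using assms
  by (metis (no_types, lifting) head_arev image_eqI pre_digraph.select_convs(2,3,4)
      pre_digraph.surjective pre_digraph.update_convs(2) subsetD tail_arev)

lemma spanning_subgraph_cas [simp]: "pre_digraph.cas (spanning_subgraph S) = cas"
  by (rule compatible_cas) (simp add: compatible_def)

lemma spanning_subgraph_awalk_verts [simp]:
  "pre_digraph.awalk_verts (spanning_subgraph S) = awalk_verts"
  by (rule compatible_awalk_verts) (simp add: compatible_def)

lemma spanning_subgraph_awalk:
  "S \<subseteq> arcs G \<Longrightarrow> pre_digraph.awalk (spanning_subgraph S) u p v \<longleftrightarrow> awalk u p v \<and> set p \<subseteq> S"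
  by (auto simp: pre_digraph.awalk_def)

lemma spanning_subgraph_apath:
  "S \<subseteq> arcs G \<Longrightarrow> pre_digraph.apath (spanning_subgraph S) u p v \<longleftrightarrow> apath u p v \<and> set p \<subseteq> S"
  by (auto simp: pre_digraph.apath_def spanning_subgraph_awalk)

lemma spanning_subgraph_cycle:
  "S \<subseteq> arcs G \<Longrightarrow> pre_digraph.cycle (spanning_subgraph S) p \<longleftrightarrow> cycle p \<and> set p \<subseteq> S"
  by (auto simp: pre_digraph.cycle_def spanning_subgraph_awalk)

text \<open>Closure under \<open>rv\<close> makes the subgraph symmetric, so that weak connectivity
  already yields directed paths.\<close>

lemma connected_subgraph_apath:
  assumes "S \<subseteq> arcs G" "rv ` S = S" "connected (spanning_subgraph S)" "u \<in> verts G" "v \<in> verts G"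
  obtains p where "apath u p v" "set p \<subseteq> S"
proof -
  interpret H: wf_digraph "spanning_subgraph S" by (rule wf_spanning_subgraph[OF assms(1)])
  have "strongly_connected (spanning_subgraph S)"
    using H.symmetric_connected_imp_strongly_connected symmetric_spanning_subgraph assms by blast
  then have "u \<rightarrow>\<^sup>*\<^bsub>spanning_subgraph S\<^esub> v"
    using assms by (auto simp: strongly_connected_def)
  then show thesis
    using H.reachable_apath that spanning_subgraph_apath[OF assms(1)] by auto
qed

lemma rv_image_arcs: "rv ` arcs G = arcs G"
  using arev_permutes_arcs permutes_image by blast

lemma spanning_subgraph_arcs [simp]: "spanning_subgraph (arcs G) = G"
  by simp

lemma connected_closed:
  assumes "S \<subseteq> verts G" "S \<noteq> {}" and closed: "\<And>a. a \<in> arcs G \<Longrightarrow> tail G a \<in> S \<Longrightarrow> head G a \<in> S"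
  shows "S = verts G"
proof -
  obtain u where u: "u \<in> S" using assms by blast
  have "awalk u p v \<Longrightarrow> u \<in> S \<Longrightarrow> v \<in> S" for u p v
    by (induction p arbitrary: u) (auto simp: awalk_simps closed)
  moreover have "\<exists>p. awalk u p v" if "v \<in> verts G" for v
    using connected_subgraph_apath[of "arcs G" u v] u assms(1) that connected_graph rv_image_arcs
    by (metis awalkI_apath order_refl spanning_subgraph_arcs subsetD)
  ultimately show ?thesis using u assms(1) by blast
qed

lemma connected_spanning_subgraphI:
  assumes S: "S \<subseteq> arcs G"
    and closed: "\<And>U. U \<subseteq> verts G \<Longrightarrow> U \<noteq> {} \<Longrightarrow>
      (\<And>a. a \<in> S \<Longrightarrow> tail G a \<in> U \<Longrightarrow> head G a \<in> U) \<Longrightarrow> U = verts G"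
  shows "connected (spanning_subgraph S)"
  using wf_digraph.connectedI_closed[OF wf_spanning_subgraph[OF S]] closed verts_nonempty by simp

section \<open>Rooted rotor configurations and their trees\<close>

text \<open>The depth function \<open>d\<close> witnesses that following \<open>\<rho>\<close> from any vertex leads to \<open>q\<close>.\<close>

definition rooted :: "'a \<Rightarrow> ('a \<Rightarrow> 'b) \<Rightarrow> ('a \<Rightarrow> nat) \<Rightarrow> bool" where
  "rooted q \<rho> d \<longleftrightarrow> q \<in> verts G \<and>
     (\<forall>v\<in>verts G - {q}. \<rho> v \<in> out_arcs G v \<and> d (head G (\<rho> v)) < d v)"

definition tree_arcs :: "'a \<Rightarrow> ('a \<Rightarrow> 'b) \<Rightarrow> 'b set" where
  "tree_arcs q \<rho> = \<rho> ` (verts G - {q}) \<union> rv ` \<rho> ` (verts G - {q})"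

lemma rv_tree_arcs: "rv ` tree_arcs q \<rho> = tree_arcs q \<rho>"
  unfolding tree_arcs_def by (simp add: image_Un image_image Un_commute)

lemma tree_arcs_subset: "rooted q \<rho> d \<Longrightarrow> tree_arcs q \<rho> \<subseteq> arcs G"
  unfolding tree_arcs_def rooted_def by (auto intro!: arev_in_arcs)

lemma rootedD:
  assumes "rooted q \<rho> d" "v \<in> verts G" "v \<noteq> q"
  shows "\<rho> v \<in> arcs G" "tail G (\<rho> v) = v" "d (head G (\<rho> v)) < d v"
  using assms unfolding rooted_def by auto

text \<open>\<open>up\<close> means towards the root. The depth inequalities are part of the cases
  because later arguments decide between them by comparing the depths of the two ends.\<close>

lemma tree_arcs_cases:
  assumes "a \<in> tree_arcs q \<rho>" "rooted q \<rho> d"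
  obtains (up) "tail G a \<in> verts G" "tail G a \<noteq> q" "a = \<rho> (tail G a)" "d (head G a) < d (tail G a)"
  | (down) "head G a \<in> verts G" "head G a \<noteq> q" "a = rv (\<rho> (head G a))" "d (tail G a) < d (head G a)"
proof -
  consider v where "v \<in> verts G" "v \<noteq> q" "a = \<rho> v" | v where "v \<in> verts G" "v \<noteq> q" "a = rv (\<rho> v)"
    using assms(1) unfolding tree_arcs_def by blast
  then show thesis
  proof cases
    case (1 v)
    then show thesis using up rootedD[OF assms(2) 1(1,2)] by auto
  next
    case (2 v)
    then show thesis using down rootedD[OF assms(2) 2(1,2)] by auto
  qed
qed

text \<open>Both the rotor arc of a vertex and its reversal belong to the tree. So for a closed set,
  membership of a vertex agrees with that of the next vertex on its rotor path and, by induction on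
  depth, with that of \<open>q\<close>.\<close>

lemma connected_tree_arcs:
  assumes r: "rooted q \<rho> d"
  shows "connected (spanning_subgraph (tree_arcs q \<rho>))"
proof (rule connected_spanning_subgraphI[OF tree_arcs_subset[OF r]])
  fix U assume U: "U \<subseteq> verts G" "U \<noteq> {}"
    and closed: "\<And>a. a \<in> tree_arcs q \<rho> \<Longrightarrow> tail G a \<in> U \<Longrightarrow> head G a \<in> U"
  have up: "v \<in> U \<longleftrightarrow> q \<in> U" if "v \<in> verts G" for v
    using that
  proof (induction "d v" arbitrary: v rule: less_induct)
    case less
    show ?case
    proof (cases "v = q")
      case False
      note v = rootedD[OF r less.prems False]
      have "\<rho> v \<in> tree_arcs q \<rho>" "rv (\<rho> v) \<in> tree_arcs q \<rho>"
        using less.prems False unfolding tree_arcs_def by auto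
      then have "v \<in> U \<longleftrightarrow> head G (\<rho> v) \<in> U"
        using closed[of "\<rho> v"] closed[of "rv (\<rho> v)"] v by auto
      then show ?thesis using less.hyps[OF v(3)] v(1) by simp
    qed simp
  qed
  then show "U = verts G" using U by blast
qed

text \<open>After leaving along an arc \<open>e\<close>, a path never returns to the tail of
  \<open>e\<close>, which is the head of \<open>rv e\<close>.\<close>

lemma apath_no_reversal:
  assumes "apath u p v" "a \<in> set p"
  shows "rv a \<notin> set p"
proof
  assume ra: "rv a \<in> set p"
  have *: "awalk u p v \<Longrightarrow> b \<in> set p \<Longrightarrow> tail G b \<in> set (awalk_verts u p) \<and> head G b \<in> set (awalk_verts u p)"
    for u p b
    by (induction p arbitrary: u) (auto simp: awalk_simps hd_in_awalk_verts)
  show False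
    using assms ra
  proof (induction p arbitrary: u)
    case (Cons e p)
    then have e: "e \<in> arcs G" "tail G e \<notin> set (awalk_verts (head G e) p)" "apath (head G e) p v"
      by (auto simp: apath_Cons_iff)
    have "b \<noteq> rv e" if "b \<in> set p" for b
      using *[OF awalkI_apath[OF e(3)] that] e(1,2) by auto
    moreover have "a \<in> arcs G" using Cons.prems unfolding apath_def awalk_def by blast
    ultimately show ?case using Cons.prems Cons.IH[OF e(3)] arev_neq[OF e(1)] by (metis arev_arev set_ConsD)
  qed simp
qed

text \<open>A path in \<open>S\<close> from the head of \<open>a\<close> back to its tail is closed
  up by \<open>a\<close>. The absence of reversals is recorded because \<open>spanning_trees\<close>
  forbids only cycles with that property.\<close>

lemma fundamental_cycle:
  assumes "S \<subseteq> arcs G" "rv ` S = S" "connected (spanning_subgraph S)" "a \<in> arcs G" "a \<notin> S"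
  obtains p where "set p \<subseteq> S" "cycle (a # p)" "\<forall>b\<in>set (a # p). rv b \<notin> set (a # p)"
proof -
  obtain p where p: "apath (head G a) p (tail G a)" "set p \<subseteq> S"
    using connected_subgraph_apath[OF assms(1-3), of "head G a" "tail G a"] assms(4) by auto
  have "cycle (a # p)"
    using p assms(4) unfolding cycle_def apath_def
    by (intro exI[of _ "tail G a"]) (auto simp: awalk_simps)
  moreover have "rv a \<notin> S" using assms(2,5) by (metis arev_arev imageI)
  then have "\<forall>b\<in>set (a # p). rv b \<notin> set (a # p)"
    using p apath_no_reversal[OF p(1)] assms(4,5) arev_neq[OF assms(4)] by auto
  ultimately show thesis using that p by blast
qed

text \<open>At a vertex of maximal depth on a cycle, the arc entering it is the reversal of its
  rotor and the arc leaving it is its rotor, so the cycle contains an arc together with its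
  reversal.\<close>

lemma tree_arcs_spanning_tree:
  assumes r: "rooted q \<rho> d"
  shows "tree_arcs q \<rho> \<in> spanning_trees G rv"
proof -
  have False if p: "cycle p" "set p \<subseteq> tree_arcs q \<rho>" and no_rev: "\<forall>a\<in>set p. rv a \<notin> set p" for p
  proof -
    obtain u where u: "awalk u p u" "p \<noteq> []" using p(1) unfolding cycle_def by blast
    have succ: "awalk u p v \<Longrightarrow> a \<in> set p \<Longrightarrow> head G a = v \<or> (\<exists>b\<in>set p. tail G b = head G a)" for u p v a
    proof (induction p arbitrary: u)
      case (Cons e p)
      then have "e \<in> arcs G" "tail G e = u" "awalk (head G e) p v" by (auto simp: awalk_simps)
      then show ?case using Cons.IH[of "head G e"] Cons.prems(2)
        by (cases p) (auto simp: awalk_simps)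
    qed simp
    have pred: "awalk u p v \<Longrightarrow> a \<in> set p \<Longrightarrow> tail G a = u \<or> (\<exists>b\<in>set p. head G b = tail G a)" for u p v a
    proof (induction p arbitrary: u)
      case (Cons e p)
      then have "e \<in> arcs G" "tail G e = u" "awalk (head G e) p v" by (auto simp: awalk_simps)
      then show ?case using Cons.IH[of "head G e"] Cons.prems(2) by auto
    qed simp
    have first: "\<exists>b\<in>set p. tail G b = u" using u by (cases p) (auto simp: awalk_simps)
    have last: "\<exists>b\<in>set p. head G b = u"
      using u by (cases p rule: rev_cases) (auto simp: awalk_simps)
    define M where "M = Max (d ` head G ` set p)"
    have fin: "finite (d ` head G ` set p)" "d ` head G ` set p \<noteq> {}" using u by auto
    from Max_in[OF fin] obtain a where a: "a \<in> set p" "d (head G a) = M" unfolding M_def by auto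
    have le: "d (head G b) \<le> M" if "b \<in> set p" for b
      unfolding M_def using fin that by auto
    have "d (tail G a) \<le> M" using pred[OF u(1) a(1)] last le by metis
    moreover have "a \<in> tree_arcs q \<rho>" using a p by blast
    ultimately have A: "a = rv (\<rho> (head G a))"
      using a(2) by (auto elim: tree_arcs_cases[OF _ r])
    obtain b where b: "b \<in> set p" "tail G b = head G a"
      using succ[OF u(1) a(1)] first by metis
    have "b \<in> tree_arcs q \<rho>" using b p by blast
    then have "b = \<rho> (head G a)"
      using le[OF b(1)] b(2) a(2) by (auto elim: tree_arcs_cases[OF _ r])
    then show False using A(1) no_rev b(1) a(1) by (metis)
  qed
  then show ?thesis
    unfolding spanning_trees_def
    using connected_tree_arcs[OF r] tree_arcs_subset[OF r] rv_tree_arcs spanning_subgraph_cycle by blast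
qed

lemma spanning_treesD:
  assumes "T \<in> spanning_trees G rv"
  shows "T \<subseteq> arcs G" "rv ` T = T" "connected (spanning_subgraph T)"
    "\<And>p. cycle p \<Longrightarrow> set p \<subseteq> T \<Longrightarrow> \<exists>a\<in>set p. rv a \<in> set p"
  using assms unfolding spanning_trees_def by (auto simp: spanning_subgraph_cycle)

text \<open>Breadth-first search from \<open>q\<close>: \<open>d\<close> is the distance to
  \<open>q\<close> within \<open>S\<close>, and the rotor is the first arc of a shortest
  walk.\<close>

lemma connected_imp_rooted:
  assumes S: "S \<subseteq> arcs G" "rv ` S = S" "connected (spanning_subgraph S)" and q: "q \<in> verts G"
  obtains \<rho> d where "rooted q \<rho> d" "tree_arcs q \<rho> \<subseteq> S"
proof -
  define P where "P = (\<lambda>v n. \<exists>p. awalk v p q \<and> set p \<subseteq> S \<and> length p = n)"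
  define d where "d = (\<lambda>v. LEAST n. P v n)"
  have "\<exists>a. a \<in> S \<and> a \<in> out_arcs G v \<and> d (head G a) < d v" if v: "v \<in> verts G - {q}" for v
  proof -
    obtain p where "apath v p q" "set p \<subseteq> S"
      using connected_subgraph_apath[OF S, of v q] v q by auto
    then have "\<exists>n. P v n" unfolding P_def apath_def by blast
    then have "P v (d v)" unfolding d_def by (rule LeastI_ex)
    then obtain p where p: "awalk v p q" "set p \<subseteq> S" "length p = d v" unfolding P_def by blast
    then obtain a p' where ap: "p = a # p'" using v by (cases p) (auto simp: awalk_simps)
    then have "P (head G a) (length p')" using p unfolding P_def by (auto simp: awalk_simps)
    then have "d (head G a) \<le> length p'" unfolding d_def by (rule Least_le)
    then show ?thesis using p ap by (auto simp: awalk_simps)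
  qed
  then obtain \<rho> where \<rho>: "\<And>v. v \<in> verts G - {q} \<Longrightarrow> \<rho> v \<in> S \<and> \<rho> v \<in> out_arcs G v \<and> d (head G (\<rho> v)) < d v"
    by metis
  have "rooted q \<rho> d" unfolding rooted_def using \<rho> q by blast
  moreover have "tree_arcs q \<rho> \<subseteq> S"
    unfolding tree_arcs_def using \<rho> S(2) by blast
  ultimately show thesis using that by blast
qed

lemma rooted_exists:
  assumes "q \<in> verts G"
  obtains \<rho> d where "rooted q \<rho> d"
proof -
  have "connected (spanning_subgraph (arcs G))" using connected_graph by simp
  from connected_imp_rooted[OF order_refl rv_image_arcs this assms] that show thesis by blast
qed

text \<open>A path to \<open>q\<close> must start with the rotor. If it started away from the root,
  then by induction its second arc would be the rotor of the vertex reached, which is the reversal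
  of the first arc, and the path would return to \<open>v\<close>.\<close>

lemma rooted_apath:
  assumes r: "rooted q \<rho> d" and "v \<in> verts G"
  shows "\<exists>!p. apath v p q \<and> set p \<subseteq> tree_arcs q \<rho>"
    and "v \<noteq> q \<Longrightarrow> apath v p q \<Longrightarrow> set p \<subseteq> tree_arcs q \<rho> \<Longrightarrow> hd p = \<rho> v"
proof -
  have hd: "hd p = \<rho> v" if "v \<noteq> q" "apath v p q" "set p \<subseteq> tree_arcs q \<rho>" for v p
    using that
  proof (induction p arbitrary: v)
    case Nil
    then show ?case by (simp add: apath_simps)
  next
    case (Cons a p)
    then have a: "a \<in> arcs G" "tail G a = v" "apath (head G a) p q"
      "v \<notin> set (awalk_verts (head G a) p)" "a \<in> tree_arcs q \<rho>"
      by (auto simp: apath_simps)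
    from a(5) r show ?case
    proof (cases rule: tree_arcs_cases)
      case up
      then show ?thesis using a by simp
    next
      case down
      then have h: "hd p = \<rho> (head G a)" using Cons a by auto
      obtain b p' where p: "p = b # p'" using a(3) down by (cases p) (auto simp: apath_simps)
      then have "b = rv a" using h down(3) by (metis arev_arev list.sel(1))
      then have "v \<in> set (awalk_verts (head G a) p)"
        using p a by (simp add: set_awalk_verts_cas) (metis apath_Cons_iff hd_in_awalk_verts(2) head_arev)
      then show ?thesis using a by blast
    qed
  qed
  then show "v \<noteq> q \<Longrightarrow> apath v p q \<Longrightarrow> set p \<subseteq> tree_arcs q \<rho> \<Longrightarrow> hd p = \<rho> v" by blast
  have "p = p'" if "apath v p q" "set p \<subseteq> tree_arcs q \<rho>" "apath v p' q" "set p' \<subseteq> tree_arcs q \<rho>" for p p'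
    using that
  proof (induction p arbitrary: v p')
    case Nil
    then show ?case using apath_nonempty_ends by (auto simp: apath_simps)
  next
    case (Cons a p)
    then have ne: "v \<noteq> q" using apath_nonempty_ends by blast
    then obtain b p'' where p': "p' = b # p''" using Cons.prems by (cases p') (auto simp: apath_simps)
    have "a = b" using hd[OF ne Cons.prems(1,2)] hd[OF ne Cons.prems(3,4)] p' by simp
    then show ?case using Cons p' by (auto simp: apath_simps)
  qed
  moreover obtain p where "apath v p q" "set p \<subseteq> tree_arcs q \<rho>"
    using connected_subgraph_apath[OF tree_arcs_subset[OF r] rv_tree_arcs connected_tree_arcs[OF r], of v q]
      assms unfolding rooted_def by blast
  ultimately show "\<exists>!p. apath v p q \<and> set p \<subseteq> tree_arcs q \<rho>" by blast
qed

lemma tree_rotor_tree_arcs: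
  assumes r: "rooted q \<rho> d" and v: "v \<in> verts G" "v \<noteq> q"
  shows "tree_rotor G q (tree_arcs q \<rho>) v = \<rho> v"
proof -
  note ex1 = rooted_apath(1)[OF r v(1)]
  define p where "p = (THE p. apath v p q \<and> set p \<subseteq> tree_arcs q \<rho>)"
  have "apath v p q \<and> set p \<subseteq> tree_arcs q \<rho>" unfolding p_def by (rule theI'[OF ex1])
  then show ?thesis
    using rooted_apath(2)[OF r v]
    unfolding tree_rotor_def spanning_subgraph_apath[OF tree_arcs_subset[OF r]] p_def by blast
qed

text \<open>\<open>T\<close> contains the tree of some rooted configuration. A further arc of
  \<open>T\<close> would close a fundamental cycle inside \<open>T\<close>, so the two
  agree.\<close>

lemma spanning_tree_rooted:
  assumes T: "T \<in> spanning_trees G rv" and q: "q \<in> verts G"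
  obtains d where "rooted q (tree_rotor G q T) d" "T = tree_arcs q (tree_rotor G q T)"
proof -
  note Ts = spanning_treesD[OF T]
  obtain \<rho> d where r: "rooted q \<rho> d" "tree_arcs q \<rho> \<subseteq> T"
    using connected_imp_rooted[OF Ts(1-3) q] by blast
  have "T \<subseteq> tree_arcs q \<rho>"
  proof (rule ccontr)
    assume "\<not> T \<subseteq> tree_arcs q \<rho>"
    then obtain a where a: "a \<in> T" "a \<notin> tree_arcs q \<rho>" by blast
    then obtain p where p: "set p \<subseteq> tree_arcs q \<rho>" "cycle (a # p)" "\<forall>b\<in>set (a # p). rv b \<notin> set (a # p)"
      using fundamental_cycle[OF tree_arcs_subset[OF r(1)] rv_tree_arcs connected_tree_arcs[OF r(1)], of a] Ts(1)
      by blast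
    then show False using Ts(4)[of "a # p"] r(2) a(1) by auto
  qed
  then have T_eq: "T = tree_arcs q \<rho>" using r by blast
  have rot: "tree_rotor G q T v = \<rho> v" if "v \<in> verts G" "v \<noteq> q" for v
    using tree_rotor_tree_arcs[OF r(1) that] T_eq by simp
  have "rooted q (tree_rotor G q T) d"
    using r(1) rot unfolding rooted_def by auto
  moreover have "T = tree_arcs q (tree_rotor G q T)"
    unfolding T_eq[unfolded tree_arcs_def] tree_arcs_def using rot
    by (metis (no_types, lifting) Diff_iff T_eq image_cong insertI1 tree_arcs_def)
  ultimately show thesis using that by blast
qed

end

section \<open>Flows and the Laplacian\<close>

definition outflow :: "('a, 'b) pre_digraph \<Rightarrow> ('b \<Rightarrow> int) \<Rightarrow> 'a \<Rightarrow> int" where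
  "outflow G z v = (\<Sum>a\<in>out_arcs G v. z a)"

definition skew :: "('a, 'b) pre_digraph \<Rightarrow> ('b \<Rightarrow> 'b) \<Rightarrow> ('b \<Rightarrow> int) \<Rightarrow> bool" where
  "skew G rv z \<longleftrightarrow> (\<forall>a\<in>arcs G. z (rv a) = - z a)"

text \<open>Oriented so that flow runs from high to low potential; this is the source of the sign in
  \<open>outflow_grad\<close>.\<close>

definition grad :: "('a, 'b) pre_digraph \<Rightarrow> ('a \<Rightarrow> int) \<Rightarrow> 'b \<Rightarrow> int" where
  "grad G g a = g (tail G a) - g (head G a)"

text \<open>The net number of chips that \<open>v\<close> gains when every vertex \<open>u\<close>
  lends \<open>k u\<close> times.\<close>

definition laplacian :: "('a, 'b) pre_digraph \<Rightarrow> ('a \<Rightarrow> int) \<Rightarrow> 'a \<Rightarrow> int" where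
  "laplacian G k v = (\<Sum>a\<in>out_arcs G v. k (head G a) - k v)"

lemma outflow_add: "outflow G (\<lambda>a. y a + z a) v = outflow G y v + outflow G z v"
  by (simp add: outflow_def sum.distrib)

lemma outflow_diff: "outflow G (\<lambda>a. y a - z a) v = outflow G y v - outflow G z v"
  by (simp add: outflow_def sum_subtractf)

lemma outflow_grad: "outflow G (grad G g) v = - laplacian G g v"
  by (auto simp: outflow_def grad_def laplacian_def simp flip: sum_negf intro!: sum.cong)

lemma laplacian_add: "laplacian G (\<lambda>v. g v + h v) v = laplacian G g v + laplacian G h v"
  by (simp add: laplacian_def flip: sum.distrib) (simp add: algebra_simps)

lemma laplacian_minus: "laplacian G (\<lambda>v. - g v) v = - laplacian G g v"
  by (simp add: laplacian_def flip: sum_negf)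

lemma laplacian_diff: "laplacian G (\<lambda>v. g v - h v) v = laplacian G g v - laplacian G h v"
  by (simp add: laplacian_def flip: sum_subtractf) (simp add: algebra_simps)

lemma laplacian_add_const: "laplacian G (\<lambda>v. g v + c) v = laplacian G g v"
  by (simp add: laplacian_def)

section \<open>Summation by parts, flows on trees and dominating potentials\<close>

context connected_multigraph
begin

lemma skew_grad: "skew G rv (grad G g)"
  by (simp add: skew_def grad_def)

lemma skewD: "skew G rv z \<Longrightarrow> a \<in> arcs G \<Longrightarrow> z (rv a) = - z a"
  by (simp add: skew_def)

lemma sum_arcs_by_tail: "(\<Sum>a\<in>arcs G. f a) = (\<Sum>v\<in>verts G. \<Sum>a\<in>out_arcs G v. f a)"
proof -
  have "(\<Sum>v\<in>verts G. \<Sum>a\<in>{a \<in> arcs G. tail G a = v}. f a) = (\<Sum>a\<in>arcs G. f a)"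
    by (rule sum.group) auto
  then show ?thesis by (simp add: out_arcs_def)
qed

lemma sum_arcs_reverse: "(\<Sum>a\<in>arcs G. f (rv a)) = (\<Sum>a\<in>arcs G. f a)"
  using sum.permute[OF arev_permutes_arcs, of f] by (simp add: o_def)

text \<open>Discrete Green's identity. The factor 2 arises because every edge is counted as two
  arcs. In particular, gradients are orthogonal to circulations.\<close>

lemma grad_pairing:
  assumes "skew G rv y"
  shows "(\<Sum>a\<in>arcs G. grad G g a * y a) = 2 * (\<Sum>v\<in>verts G. g v * outflow G y v)"
proof -
  have "(\<Sum>a\<in>arcs G. g (head G a) * y a) = (\<Sum>a\<in>arcs G. g (head G (rv a)) * y (rv a))"
    by (rule sum_arcs_reverse[symmetric])
  also have "\<dots> = (\<Sum>a\<in>arcs G. - (g (tail G a) * y a))"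
    using assms by (intro sum.cong) (auto simp: skewD)
  finally have "(\<Sum>a\<in>arcs G. grad G g a * y a) = 2 * (\<Sum>a\<in>arcs G. g (tail G a) * y a)"
    by (simp add: grad_def left_diff_distrib sum_subtractf sum_negf)
  also have "(\<Sum>a\<in>arcs G. g (tail G a) * y a) = (\<Sum>v\<in>verts G. g v * outflow G y v)"
    by (simp add: sum_arcs_by_tail outflow_def sum_distrib_left)
  finally show ?thesis .
qed

lemma sum_outflow: "skew G rv y \<Longrightarrow> (\<Sum>v\<in>verts G. outflow G y v) = 0"
  using grad_pairing[of y "\<lambda>_. 1"] by (simp add: grad_def)

text \<open>Work from the deepest vertices towards the root: once the flow vanishes on the arcs to
  the children of \<open>v\<close>, the rotor arc alone carries the outflow of
  \<open>v\<close>.\<close>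

lemma tree_flow_zero:
  assumes r: "rooted q \<rho> d" and z: "skew G rv z"
    and supp: "\<And>a. a \<in> arcs G \<Longrightarrow> a \<notin> tree_arcs q \<rho> \<Longrightarrow> z a = 0"
    and flow: "\<And>v. v \<in> verts G \<Longrightarrow> v \<noteq> q \<Longrightarrow> outflow G z v = 0"
    and a: "a \<in> arcs G"
  shows "z a = 0"
proof -
  define M where "M = Max (d ` verts G)"
  have le: "d v \<le> M" if "v \<in> verts G" for v unfolding M_def using that by simp
  have up: "z (\<rho> v) = 0" if "v \<in> verts G" "v \<noteq> q" for v
    using that
  proof (induction "M - d v" arbitrary: v rule: less_induct)
    case less
    note v = rootedD[OF r less.prems]
    have "z a = 0" if a: "a \<in> out_arcs G v - {\<rho> v}" for a
    proof (cases "a \<in> tree_arcs q \<rho>")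
      case True
      then show ?thesis using r
      proof (cases rule: tree_arcs_cases)
        case up
        then show ?thesis using a by auto
      next
        case down
        then have "z (\<rho> (head G a)) = 0"
          using less.hyps[of "head G a"] le[of "head G a"] a by auto
        then show ?thesis using skewD[OF z, of "\<rho> (head G a)"] down rootedD(1)[OF r down(1,2)] by simp
      qed
    qed (use a supp in auto)
    then have "outflow G z v = z (\<rho> v)"
      unfolding outflow_def using v by (subst sum.remove[of _ "\<rho> v"]) (auto intro!: sum.neutral)
    then show ?case using flow less.prems by simp
  qed
  show ?thesis
  proof (cases "a \<in> tree_arcs q \<rho>")
    case True
    then show ?thesis using r
    proof (cases rule: tree_arcs_cases)
      case up
      then show ?thesis using \<open>\<And>v. v \<in> verts G \<Longrightarrow> v \<noteq> q \<Longrightarrow> z (\<rho> v) = 0\<close> by metis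
    next
      case down
      then show ?thesis using \<open>\<And>v. v \<in> verts G \<Longrightarrow> v \<noteq> q \<Longrightarrow> z (\<rho> v) = 0\<close>[OF down(1,2)]
          skewD[OF z, of "\<rho> (head G a)"] rootedD(1)[OF r down(1,2)] by simp
    qed
  qed (use supp a in blast)
qed

text \<open>Integrate \<open>z\<close> along the rotor paths from \<open>q\<close>, extending the
  potential by one level of depth at a time.\<close>

lemma tree_potential:
  assumes r: "rooted q \<rho> d" and z: "skew G rv z"
  obtains h where "\<And>a. a \<in> tree_arcs q \<rho> \<Longrightarrow> grad G h a = z a"
proof -
  have "\<exists>h. \<forall>v\<in>verts G - {q}. d v < n \<longrightarrow> h v = h (head G (\<rho> v)) + z (\<rho> v)" for n
  proof (induction n)
    case (Suc n)
    then obtain h where h: "\<forall>v\<in>verts G - {q}. d v < n \<longrightarrow> h v = h (head G (\<rho> v)) + z (\<rho> v)" by blast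
    define h' where "h' = (\<lambda>v. if d v = n \<and> v \<in> verts G - {q} then h (head G (\<rho> v)) + z (\<rho> v) else h v)"
    have "\<forall>v\<in>verts G - {q}. d v < Suc n \<longrightarrow> h' v = h' (head G (\<rho> v)) + z (\<rho> v)"
    proof (intro ballI impI)
      fix v assume v: "v \<in> verts G - {q}" "d v < Suc n"
      then have "d (head G (\<rho> v)) < n" using rootedD(3)[OF r, of v] by simp
      then have "h' (head G (\<rho> v)) = h (head G (\<rho> v))" by (simp add: h'_def)
      then show "h' v = h' (head G (\<rho> v)) + z (\<rho> v)"
        using h v unfolding h'_def by (auto simp: less_Suc_eq)
    qed
    then show ?case by blast
  qed simp
  from this[of "Suc (Max (d ` verts G))"] obtain h where
    "\<forall>v\<in>verts G - {q}. d v < Suc (Max (d ` verts G)) \<longrightarrow> h v = h (head G (\<rho> v)) + z (\<rho> v)" by blast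
  moreover have "d v < Suc (Max (d ` verts G))" if "v \<in> verts G" for v
    using that by (simp add: less_Suc_eq_le)
  ultimately have h: "h v = h (head G (\<rho> v)) + z (\<rho> v)" if "v \<in> verts G" "v \<noteq> q" for v
    using that by auto
  have "grad G h a = z a" if "a \<in> tree_arcs q \<rho>" for a
    using that r
  proof (cases rule: tree_arcs_cases)
    case up
    then show ?thesis using h[OF up(1,2)] by (simp add: grad_def)
  next
    case down
    have "z a = - z (\<rho> (head G a))" using skewD[OF z rootedD(1)[OF r down(1,2)]] down(3) by metis
    moreover have "tail G a = head G (\<rho> (head G a))"
      using rootedD(1)[OF r down(1,2)] down(3) by (metis tail_arev)
    ultimately show ?thesis using h[OF down(1,2)] by (simp add: grad_def)
  qed
  then show thesis using that by blast
qed

text \<open>Lending from all of a vertex set never harms the vertices outside it; the sets are grown from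
  \<open>{q}\<close> one neighbour at a time.\<close>

lemma laplacian_dominates:
  assumes q: "q \<in> verts G"
  obtains k where "\<And>v. v \<in> verts G \<Longrightarrow> v \<noteq> q \<Longrightarrow> D v \<le> laplacian G k v"
proof -
  define good where "good = (\<lambda>U. \<forall>D. \<exists>k. (\<forall>v\<in>verts G - U. 0 \<le> laplacian G k v) \<and>
    (\<forall>v\<in>U - {q}. D v \<le> laplacian G k v))"
  have "good (verts G)" if "U \<subseteq> verts G" "q \<in> U" "good U" for U
    using that
  proof (induction "card (verts G - U)" arbitrary: U rule: less_induct)
    case less
    show ?case
    proof (cases "U = verts G")
      case False
      then obtain b where b: "b \<in> arcs G" "tail G b \<in> U" "head G b \<notin> U"
        using connected_closed[of U] less.prems by blast
      define u where "u = head G b"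
      have u: "u \<in> verts G" "u \<notin> U" using b unfolding u_def by auto
      define \<chi> where "\<chi> = (\<lambda>v. if v \<in> U then 1 else 0 :: int)"
      have lap_chi: "laplacian G (\<lambda>w. m * \<chi> w) v \<ge> 0" if "v \<notin> U" "m \<ge> 0" for v m
        unfolding laplacian_def using that by (intro sum_nonneg) (auto simp: \<chi>_def)
      have lap_chi_u: "laplacian G (\<lambda>w. m * \<chi> w) u \<ge> m" if m: "m \<ge> 0" for m
      proof -
        have "m * \<chi> (head G (rv b)) - m * \<chi> u \<le> laplacian G (\<lambda>w. m * \<chi> w) u"
          unfolding laplacian_def using b m u
          by (intro member_le_sum) (auto simp: \<chi>_def u_def)
        then show ?thesis using b u by (simp add: \<chi>_def)
      qed
      have "good (insert u U)" unfolding good_def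
      proof
        fix D :: "'a \<Rightarrow> int"
        \<comment> \<open>Lending \<open>m\<close> times from all of \<open>U\<close> meets the
          demand of the neighbour \<open>u\<close>. The debts this causes inside \<open>U\<close>
          become part of the demand met by \<open>k2\<close>; for this reason \<open>good\<close>
          quantifies over all \<open>D\<close>.\<close>
        define m where "m = max 0 (D u)"
        define k1 where "k1 = (\<lambda>w. m * \<chi> w)"
        obtain k2 where k2: "\<forall>v\<in>verts G - U. 0 \<le> laplacian G k2 v"
          "\<forall>v\<in>U - {q}. D v - laplacian G k1 v \<le> laplacian G k2 v"
          using less.prems(3) unfolding good_def by (elim allE[of _ "\<lambda>v. D v - laplacian G k1 v"]) blast
        have *: "laplacian G (\<lambda>v. k1 v + k2 v) v = laplacian G k1 v + laplacian G k2 v" for v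
          by (rule laplacian_add)
        have m: "0 \<le> m" "D u \<le> m" unfolding m_def by auto
        have k1: "v \<notin> U \<Longrightarrow> 0 \<le> laplacian G k1 v" "D u \<le> laplacian G k1 u" for v
          using lap_chi[OF _ m(1)] lap_chi_u[OF m(1)] m unfolding k1_def by (auto intro: order_trans)
        show "\<exists>k. (\<forall>v\<in>verts G - insert u U. 0 \<le> laplacian G k v) \<and>
              (\<forall>v\<in>insert u U - {q}. D v \<le> laplacian G k v)"
        proof (intro exI[of _ "\<lambda>v. k1 v + k2 v"] conjI ballI)
          fix v assume "v \<in> verts G - insert u U"
          then show "0 \<le> laplacian G (\<lambda>v. k1 v + k2 v) v"
            using k1(1)[of v] k2(1) unfolding * by auto
        next
          fix v assume v: "v \<in> insert u U - {q}"
          show "D v \<le> laplacian G (\<lambda>v. k1 v + k2 v) v"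
          proof (cases "v = u")
            case True
            then show ?thesis using k1(2) k2(1) u unfolding * by (auto intro: order_trans add_increasing2)
          next
            case False
            then have "D v - laplacian G k1 v \<le> laplacian G k2 v" using v k2(2) by blast
            then show ?thesis unfolding * by simp
          qed
        qed
      qed
      moreover have "card (verts G - insert u U) < card (verts G - U)"
        using u by (intro psubset_card_mono) auto
      ultimately show ?thesis using less.hyps[of "insert u U"] less.prems u by blast
    qed (use less.prems in simp)
  qed
  moreover have "good {q}"
    unfolding good_def by (auto intro!: exI[of _ "\<lambda>_. 0"] simp: laplacian_def)
  ultimately have "good (verts G)" using q by blast
  then show thesis using that unfolding good_def by blast
qed

end

text \<open>Take for \<open>g\<close> the partial sums of \<open>r\<close> along the cycle, starting
  with 0 at \<open>a0\<close>. The inequality is an equality except on returning to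
  \<open>a0\<close>, where it says that the total of \<open>r\<close> is nonnegative.\<close>

lemma cyclic_potential:
  assumes S: "finite S" "cyclic_on f S" and r: "(\<Sum>a\<in>S. r a) \<ge> (0::int)"
  obtains g where "\<And>a. a \<in> S \<Longrightarrow> g (f a) \<le> g a + r (f a)"
proof -
  obtain a0 where a0: "a0 \<in> S" "S = orbit f a0" using S(2) unfolding cyclic_on_def by blast
  have self: "a0 \<in> orbit f a0" using a0 by simp
  define n where "n = funpow_dist1 f a0 a0"
  have bij: "bij_betw (\<lambda>i. (f ^^ i) a0) {0..<n} S"
    unfolding bij_betw_def n_def using inj_on_funpow_dist1[OF self] orbit_conv_funpow_dist1[OF self] a0(2)
    by simp
  have wrap: "(f ^^ n) a0 = a0" unfolding n_def by (rule funpow_dist1_prop[OF self])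
  have n: "n > 0" unfolding n_def by simp
  have orb: "\<exists>i<n. a = (f ^^ i) a0" if "a \<in> S" for a
    using that bij_betw_imp_surj_on[OF bij] by auto
  define g where "g = (\<lambda>a. \<Sum>j<inv_into {0..<n} (\<lambda>i. (f ^^ i) a0) a. r ((f ^^ Suc j) a0))"
  have g: "g ((f ^^ i) a0) = (\<Sum>j<i. r ((f ^^ Suc j) a0))" if "i < n" for i
    unfolding g_def using that bij by (subst inv_into_f_f) (auto simp: bij_betw_def)
  \<comment> \<open>Every element of \<open>S\<close> has a predecessor among the iterates, that of
    \<open>a0\<close> being the last one; on a finite set surjectivity gives bijectivity, which lets
    the total be summed in cyclic order.\<close>
  have fS: "bij_betw f S S"
  proof -
    have "a \<in> f ` S" if "a \<in> S" for a
    proof -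
      obtain i where i: "i < n" "a = (f ^^ i) a0" using orb[OF \<open>a \<in> S\<close>] by blast
      obtain j where "a = f ((f ^^ j) a0)" "j < n"
      proof (cases i)
        case 0
        then show thesis using that[of "n - 1"] wrap i n
          by (metis Suc_diff_1 diff_less funpow.simps(2) funpow_0 less_numeral_extra(1) o_apply)
      next
        case (Suc j)
        then show thesis using that[of j] i by simp
      qed
      then show ?thesis using bij unfolding bij_betw_def by auto
    qed
    then have sub: "S \<subseteq> f ` S" by blast
    then have "inj_on f S" using finite_surj_inj S(1) by blast
    moreover have "f ` S = S"
      using sub S(1) by (metis card_image_le card_seteq finite_imageI)
    ultimately show ?thesis unfolding bij_betw_def by blast
  qed
  have total: "(\<Sum>j<n. r ((f ^^ Suc j) a0)) = (\<Sum>a\<in>S. r a)"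
  proof -
    have "(\<Sum>a\<in>S. r a) = (\<Sum>a\<in>S. r (f a))" by (rule sum.reindex_bij_betw[OF fS, symmetric])
    also have "\<dots> = (\<Sum>j\<in>{0..<n}. r (f ((f ^^ j) a0)))" by (rule sum.reindex_bij_betw[OF bij, symmetric])
    finally show ?thesis by (simp add: atLeast0LessThan)
  qed
  have "g (f a) \<le> g a + r (f a)" if "a \<in> S" for a
  proof -
    obtain i where i: "i < n" "a = (f ^^ i) a0" using orb[OF \<open>a \<in> S\<close>] by blast
    then have fa: "f a = (f ^^ Suc i) a0" by simp
    show ?thesis
    proof (cases "Suc i < n")
      case True
      then show ?thesis unfolding fa using g[OF i(1)] g[OF True] i by simp
    next
      case False
      then have "n = Suc i" using i by simp
      then have "g a + r (f a) \<ge> 0" using total r g[OF i(1)] i fa by simp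
      moreover have "g (f a) = 0" using g[OF n] fa wrap \<open>n = Suc i\<close> by simp
      ultimately show ?thesis by simp
    qed
  qed
  then show thesis using that by blast
qed

section \<open>Rotor-routing terminates in a spanning tree\<close>

lemma nonneg_shift:
  fixes g :: "'c \<Rightarrow> int"
  assumes "finite S"
  obtains c where "\<And>x. x \<in> S \<Longrightarrow> 0 \<le> g x + c"
proof (cases "S = {}")
  case False
  have "0 \<le> g x + (- Min (g ` S))" if "x \<in> S" for x using assms that by simp
  then show thesis using that by blast
qed (use that in simp)

inductive_cases fireE: "fire G \<sigma> q (D, \<rho>) (D', \<rho>')"

context ribbon_graph
begin

lemma succ_out_arcs: "a \<in> out_arcs G v \<Longrightarrow> \<sigma> a \<in> out_arcs G v"
  using cyclic_on_inI[OF succ_cyclic, of v a] by (metis empty_iff in_out_arcs_conv tail_in_verts)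

lemma succ_arc [simp]:
  assumes "a \<in> arcs G" shows "\<sigma> a \<in> arcs G" "tail G (\<sigma> a) = tail G a"
  using succ_out_arcs[of a "tail G a"] assms by auto

text \<open>The last clause is the invariant that prevents the final rotors from forming a cycle: from
  every vertex, the rotors lead to \<open>q\<close> or to a chip. A fired vertex moves its chip to the next vertex
  on its new rotor path.\<close>

definition routing_state :: "'a \<Rightarrow> ('a \<Rightarrow>\<^sub>0 int) \<Rightarrow> ('a \<Rightarrow> 'b) \<Rightarrow> bool" where
  "routing_state q D \<rho> \<longleftrightarrow> q \<in> verts G \<and>
     (\<forall>v\<in>verts G - {q}. 0 \<le> lookup D v \<and> \<rho> v \<in> out_arcs G v) \<and>
     (\<forall>v\<in>verts G. \<exists>n. ((\<lambda>u. head G (\<rho> u)) ^^ n) v \<in> insert q {u \<in> verts G. lookup D u > 0})"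

text \<open>An old rotor path that avoids the fired vertex \<open>u\<close> stays intact, and its
  end still qualifies. One that meets \<open>u\<close> now continues from there in one step to
  \<open>w\<close>, which is \<open>q\<close> or holds the chip just moved.\<close>

lemma fire_routing_state:
  assumes s: "routing_state q D \<rho>" and f: "fire G \<sigma> q (D, \<rho>) (D', \<rho>')"
  shows "routing_state q D' \<rho>'"
proof -
  from f obtain u where u: "u \<in> verts G" "u \<noteq> q" "lookup D u > 0"
    and D': "D' = D - frag_of u + frag_of (head G (\<sigma> (\<rho> u)))" and \<rho>': "\<rho>' = \<rho>(u := \<sigma> (\<rho> u))"
    by (auto elim: fireE)
  define w where "w = head G (\<sigma> (\<rho> u))"
  have \<rho>: "\<rho> v \<in> out_arcs G v" "0 \<le> lookup D v" if "v \<in> verts G" "v \<noteq> q" for v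
    using s that unfolding routing_state_def by blast+
  have \<rho>'_arc: "\<rho>' v \<in> out_arcs G v" if "v \<in> verts G" "v \<noteq> q" for v
    using succ_out_arcs[OF \<rho>(1)[OF u(1,2)]] \<rho>[OF that] unfolding \<rho>' by auto
  have w: "w \<in> verts G" using succ_out_arcs[OF \<rho>(1)[OF u(1,2)]] unfolding w_def by auto
  have look: "lookup D' v = lookup D v - (if v = u then 1 else 0) + (if v = w then 1 else 0)" for v
    unfolding D' w_def by (simp add: lookup_add lookup_minus)
  have pos: "w = q \<or> lookup D' w > 0"
    using look[of w] \<rho>(2)[OF w] u(3) by auto
  have ge: "v \<noteq> u \<Longrightarrow> lookup D v \<le> lookup D' v" for v
    using look[of v] by simp
  have reach: "\<exists>m. ((\<lambda>u. head G (\<rho>' u)) ^^ m) v \<in> insert q {u \<in> verts G. lookup D' u > 0}"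
    if "((\<lambda>u. head G (\<rho> u)) ^^ n) v \<in> insert q {u \<in> verts G. lookup D u > 0}" "v \<in> verts G" for n v
    using that
  proof (induction n arbitrary: v)
    case 0
    show ?case
    proof (cases "v = u")
      case True
      then show ?thesis using pos w by (intro exI[of _ 1]) (auto simp: \<rho>' w_def)
    next
      case False
      then have "v = q \<or> lookup D' v > 0" using 0 ge[OF False] by auto
      then show ?thesis using 0 by (intro exI[of _ 0]) auto
    qed
  next
    case (Suc n)
    consider "v = u" | "v = q" | "v \<noteq> u" "v \<noteq> q" by blast
    then show ?case
    proof cases
      case 1
      then show ?thesis using pos w by (intro exI[of _ 1]) (auto simp: \<rho>' w_def)
    next
      case 2
      then show ?thesis by (intro exI[of _ 0]) auto
    next
      case 3
      have "((\<lambda>u. head G (\<rho> u)) ^^ n) (head G (\<rho> v)) \<in> insert q {u \<in> verts G. lookup D u > 0}"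
        using Suc.prems(1) by (simp add: funpow_Suc_right del: funpow.simps)
      then obtain m where "((\<lambda>u. head G (\<rho>' u)) ^^ m) (head G (\<rho> v)) \<in> insert q {u \<in> verts G. lookup D' u > 0}"
        using Suc.IH[of "head G (\<rho> v)"] \<rho>(1)[OF Suc.prems(2) 3(2)] by auto
      moreover have "head G (\<rho> v) = head G (\<rho>' v)" using 3 by (simp add: \<rho>')
      ultimately show ?thesis
        by (intro exI[of _ "Suc m"]) (simp add: funpow_Suc_right del: funpow.simps)
    qed
  qed
  show ?thesis
    unfolding routing_state_def
  proof (intro conjI ballI)
    show "q \<in> verts G" using s unfolding routing_state_def by blast
    fix v assume "v \<in> verts G - {q}"
    then show "0 \<le> lookup D' v" "\<rho>' v \<in> out_arcs G v"
      using \<rho>'_arc \<rho>(2)[of v] look[of v] u(3) by auto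
  next
    fix v assume v: "v \<in> verts G"
    then show "\<exists>n. ((\<lambda>u. head G (\<rho>' u)) ^^ n) v \<in> insert q {u \<in> verts G. lookup D' u > 0}"
      using s reach unfolding routing_state_def by blast
  qed
qed

text \<open>With \<open>h\<close> strictly superharmonic off \<open>q\<close>, the expected drop of \<open>h\<close> over a full turn of a rotor
  is absorbed step by step into a potential \<open>g\<close> of the rotor positions.\<close>

lemma routing_potential:
  assumes q: "q \<in> verts G"
  obtains h g where "\<And>v. v \<in> verts G \<Longrightarrow> 0 \<le> h v" "\<And>a. a \<in> arcs G \<Longrightarrow> (0::int) \<le> g a"
    "\<And>a. a \<in> arcs G \<Longrightarrow> tail G a \<noteq> q \<Longrightarrow> h (head G (\<sigma> a)) + g (\<sigma> a) < h (tail G a) + g a"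
proof -
  \<comment> \<open>The demand at \<open>v\<close> is its degree: with \<open>h = - k + c\<close>,
    the drops of \<open>h\<close> over a full turn of the rotor at \<open>v\<close> add up to at
    least the number of its steps, which leaves one unit for each firing.\<close>
  obtain k where k: "\<And>v. v \<in> verts G \<Longrightarrow> v \<noteq> q \<Longrightarrow> int (card (out_arcs G v)) \<le> laplacian G k v"
    using laplacian_dominates[OF q, of "\<lambda>v. int (card (out_arcs G v))"] by blast
  obtain c where c: "\<And>v. v \<in> verts G \<Longrightarrow> 0 \<le> - k v + c"
    using nonneg_shift[of "verts G" "\<lambda>v. - k v"] by auto
  define h where "h = (\<lambda>v. - k v + c)"
  have lap: "laplacian G h v = - laplacian G k v" for v
    unfolding h_def laplacian_add_const laplacian_minus by simp
  have "\<exists>g. \<forall>a\<in>out_arcs G v. g (\<sigma> a) \<le> g a + (h v - h (head G (\<sigma> a)) - 1)"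
    if v: "v \<in> verts G" "v \<noteq> q" for v
  proof (cases "out_arcs G v = {}")
    case False
    have "(\<Sum>a\<in>out_arcs G v. h v - h (head G a) - 1) = - laplacian G h v - int (card (out_arcs G v))"
      by (simp add: laplacian_def sum_subtractf)
    then have "(\<Sum>a\<in>out_arcs G v. h v - h (head G a) - 1) \<ge> 0"
      using k[OF v] lap by simp
    then show ?thesis
      using cyclic_potential[of "out_arcs G v" \<sigma> "\<lambda>a. h v - h (head G a) - 1"] succ_cyclic[OF v(1) False]
      by (metis finite_out_arcs)
  qed auto
  then obtain g where g: "\<And>v a. v \<in> verts G \<Longrightarrow> v \<noteq> q \<Longrightarrow> a \<in> out_arcs G v \<Longrightarrow>
      g v (\<sigma> a) \<le> g v a + (h v - h (head G (\<sigma> a)) - 1)"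
    by metis
  obtain b where b: "\<And>a. a \<in> arcs G \<Longrightarrow> 0 \<le> g (tail G a) a + b"
    using nonneg_shift[of "arcs G" "\<lambda>a. g (tail G a) a"] by auto
  show thesis
  proof (rule that[of h "\<lambda>a. g (tail G a) a + b"])
    fix a assume a: "a \<in> arcs G" "tail G a \<noteq> q"
    then show "h (head G (\<sigma> a)) + (g (tail G (\<sigma> a)) (\<sigma> a) + b) < h (tail G a) + (g (tail G a) a + b)"
      using g[of "tail G a" a] by simp
  qed (use b c h_def in auto)
qed

lemma routing_terminates:
  assumes "routing_state q D \<rho>"
  obtains D' \<rho>' where "(fire G \<sigma> q)\<^sup>*\<^sup>* (D, \<rho>) (D', \<rho>')" "routing_state q D' \<rho>'"
    "\<And>v. v \<in> verts G \<Longrightarrow> v \<noteq> q \<Longrightarrow> lookup D' v = 0"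
proof -
  have q: "q \<in> verts G" using assms unfolding routing_state_def by blast
  obtain h g where h: "\<And>v. v \<in> verts G \<Longrightarrow> 0 \<le> h v" and g: "\<And>a. a \<in> arcs G \<Longrightarrow> (0::int) \<le> g a"
    and hg: "\<And>a. a \<in> arcs G \<Longrightarrow> tail G a \<noteq> q \<Longrightarrow> h (head G (\<sigma> a)) + g (\<sigma> a) < h (tail G a) + g a"
    using routing_potential[OF q] by blast
  \<comment> \<open>The energy of a state: chips away from \<open>q\<close> are weighted by
    \<open>h\<close>, rotors by \<open>g\<close>. Chips at \<open>q\<close> are left out, and as
    \<open>h\<close> is nonnegative, a chip arriving there only lowers the energy further.\<close>
  define \<Psi> where "\<Psi> = (\<lambda>(D :: 'a \<Rightarrow>\<^sub>0 int) \<rho>. \<Sum>v\<in>verts G - {q}. lookup D v * h v + g (\<rho> v))"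
  have "\<exists>D' \<rho>'. (fire G \<sigma> q)\<^sup>*\<^sup>* (D, \<rho>) (D', \<rho>') \<and> routing_state q D' \<rho>' \<and>
      (\<forall>v\<in>verts G - {q}. lookup D' v = 0)"
    using assms
  proof (induction "nat (\<Psi> D \<rho>)" arbitrary: D \<rho> rule: less_induct)
    case less
    show ?case
    proof (cases "\<forall>v\<in>verts G - {q}. lookup D v = 0")
      case True
      then show ?thesis using less.prems by blast
    next
      case False
      have \<rho>: "\<rho> v \<in> out_arcs G v" "0 \<le> lookup D v" if "v \<in> verts G" "v \<noteq> q" for v
        using less.prems that unfolding routing_state_def by blast+
      obtain u where u: "u \<in> verts G" "u \<noteq> q" "lookup D u > 0"
        using False \<rho>(2) by (metis DiffD1 DiffD2 insertI1 order_le_less)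
      define w where "w = head G (\<sigma> (\<rho> u))"
      define D' where "D' = D - frag_of u + frag_of w"
      define \<rho>' where "\<rho>' = \<rho>(u := \<sigma> (\<rho> u))"
      have f: "fire G \<sigma> q (D, \<rho>) (D', \<rho>')"
        unfolding D'_def w_def \<rho>'_def by (rule fire.intros[OF u])
      have arc: "\<rho> u \<in> arcs G" "tail G (\<rho> u) = u" using \<rho>(1)[OF u(1,2)] by auto
      have w: "w \<in> verts G" unfolding w_def using arc by simp
      have "\<Psi> D' \<rho>' = (\<Sum>v\<in>verts G - {q}. lookup D v * h v + g (\<rho> v)
          + (if v = u then g (\<sigma> (\<rho> u)) - g (\<rho> u) - h u else 0) + (if v = w then h w else 0))"
        unfolding \<Psi>_def D'_def \<rho>'_def by (intro sum.cong refl, auto simp: lookup_add lookup_minus algebra_simps)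
      also have "\<dots> = \<Psi> D \<rho> + (g (\<sigma> (\<rho> u)) - g (\<rho> u) - h u) + (if w = q then 0 else h w)"
        unfolding \<Psi>_def using u w by (simp add: sum.distrib)
      also have "\<dots> < \<Psi> D \<rho>"
        using hg[OF arc(1)] arc(2) u(2) h[OF w] w_def by auto
      finally have "\<Psi> D' \<rho>' < \<Psi> D \<rho>" .
      moreover have "0 \<le> \<Psi> D' \<rho>'"
        using fire_routing_state[OF less.prems f] h g
        unfolding \<Psi>_def routing_state_def by (intro sum_nonneg) (auto intro!: add_nonneg_nonneg)
      ultimately have "nat (\<Psi> D' \<rho>') < nat (\<Psi> D \<rho>)" by simp
      from less.hyps[OF this fire_routing_state[OF less.prems f]] f show ?thesis
        by (meson converse_rtranclp_into_rtranclp)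
    qed
  qed
  then show thesis using that by blast
qed

section \<open>From an initial tree to a final tree\<close>

lemma routing_state_rooted:
  assumes r: "rooted q \<rho> d" and D: "\<And>v. v \<in> verts G \<Longrightarrow> v \<noteq> q \<Longrightarrow> 0 \<le> lookup D v"
  shows "routing_state q D \<rho>"
proof -
  have "\<exists>n. ((\<lambda>u. head G (\<rho> u)) ^^ n) v = q" if "v \<in> verts G" for v
    using that
  proof (induction "d v" arbitrary: v rule: less_induct)
    case less
    show ?case
    proof (cases "v = q")
      case False
      note v = rootedD[OF r less.prems False]
      obtain n where "((\<lambda>u. head G (\<rho> u)) ^^ n) (head G (\<rho> v)) = q"
        using less.hyps[OF v(3)] v(1) by auto
      then show ?thesis by (intro exI[of _ "Suc n"]) (simp add: funpow_Suc_right del: funpow.simps)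
    qed (auto intro: exI[of _ 0])
  qed
  then show ?thesis
    using r D unfolding routing_state_def rooted_def by blast
qed

text \<open>Once no chips are left off \<open>q\<close>, the invariant says that all rotor paths end
  at \<open>q\<close>. The number of steps they take serves as depth.\<close>

lemma routing_state_final:
  assumes s: "routing_state q D \<rho>" and D: "\<And>v. v \<in> verts G \<Longrightarrow> v \<noteq> q \<Longrightarrow> lookup D v = 0"
  obtains d where "rooted q \<rho> d"
proof -
  define d where "d = (\<lambda>v. LEAST n. ((\<lambda>u. head G (\<rho> u)) ^^ n) v = q)"
  have q: "q \<in> verts G" using s unfolding routing_state_def by blast
  have reach: "\<exists>n. ((\<lambda>u. head G (\<rho> u)) ^^ n) v = q" if "v \<in> verts G" for v
  proof -
    obtain n where "((\<lambda>u. head G (\<rho> u)) ^^ n) v \<in> insert q {u \<in> verts G. lookup D u > 0}"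
      using s \<open>v \<in> verts G\<close> unfolding routing_state_def by blast
    then show ?thesis using D by (metis (mono_tags, lifting) insertE mem_Collect_eq order_less_irrefl)
  qed
  have "d (head G (\<rho> v)) < d v" if v: "v \<in> verts G" "v \<noteq> q" for v
  proof -
    have dv: "((\<lambda>u. head G (\<rho> u)) ^^ d v) v = q"
      unfolding d_def using reach[OF v(1)] by (rule LeastI_ex)
    then obtain m where m: "d v = Suc m" using v(2) by (cases "d v") auto
    then have "((\<lambda>u. head G (\<rho> u)) ^^ m) (head G (\<rho> v)) = q" using dv by (simp add: funpow_Suc_right del: funpow.simps)
    then have "d (head G (\<rho> v)) \<le> m" unfolding d_def by (rule Least_le)
    then show ?thesis using m by simp
  qed
  then have "rooted q \<rho> d" using s q unfolding rooted_def routing_state_def by blast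
  then show thesis by (rule that)
qed

lemma routes_to_exists:
  assumes T: "T \<in> spanning_trees G rv" and q: "q \<in> verts G"
    and D: "\<And>v. v \<in> verts G \<Longrightarrow> v \<noteq> q \<Longrightarrow> 0 \<le> lookup D v"
  obtains T' where "T' \<in> spanning_trees G rv" "routes_to G \<sigma> q D T T'"
proof -
  obtain d where r: "rooted q (tree_rotor G q T) d" using spanning_tree_rooted[OF T q] by blast
  obtain D' \<rho>' where f: "(fire G \<sigma> q)\<^sup>*\<^sup>* (D, tree_rotor G q T) (D', \<rho>')" "routing_state q D' \<rho>'"
    "\<And>v. v \<in> verts G \<Longrightarrow> v \<noteq> q \<Longrightarrow> lookup D' v = 0"
    using routing_terminates[OF routing_state_rooted[OF r D]] by blast
  obtain d' where r': "rooted q \<rho>' d'" using routing_state_final[OF f(2,3)] by blast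
  have "routes_to G \<sigma> q D T (tree_arcs q \<rho>')"
    unfolding routes_to_def using f(1,3) tree_rotor_tree_arcs[OF r']
    by (intro exI[of _ D'] exI[of _ \<rho>']) auto
  then show thesis using that tree_arcs_spanning_tree[OF r'] by blast
qed

end

section \<open>Divisor classes\<close>

lemma additive_closed:
  fixes H :: "('a \<Rightarrow>\<^sub>0 int) set"
  assumes zero: "0 \<in> H" and add: "\<And>x y. x \<in> H \<Longrightarrow> y \<in> H \<Longrightarrow> x + y \<in> H"
    and uminus: "\<And>x. x \<in> H \<Longrightarrow> - x \<in> H"
  shows "x \<in> H \<Longrightarrow> frag_cmul n x \<in> H" and "(\<And>i. i \<in> I \<Longrightarrow> f i \<in> H) \<Longrightarrow> sum f I \<in> H"
proof -
  show "x \<in> H \<Longrightarrow> frag_cmul n x \<in> H"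
    by (rule frag_closure_minus_cmul[of "\<lambda>x. x \<in> H"])
      (use zero add uminus in \<open>auto simp: diff_conv_add_uminus simp del: add_uminus_conv_diff\<close>)
  show "(\<And>i. i \<in> I \<Longrightarrow> f i \<in> H) \<Longrightarrow> sum f I \<in> H"
    by (induction I rule: infinite_finite_induct) (auto simp: zero add)
qed

section \<open>Linear equivalence through the Laplacian\<close>

context connected_multigraph
begin

text \<open>\<open>k v\<close> is the net number of lending moves at \<open>v\<close>. In this form
  linear equivalence combines pointwise with statements about outflows.\<close>

definition lin_equiv :: "('a \<Rightarrow>\<^sub>0 int) \<Rightarrow> ('a \<Rightarrow>\<^sub>0 int) \<Rightarrow> bool" where
  "lin_equiv D D' \<longleftrightarrow> (\<exists>k. \<forall>v\<in>verts G. lookup D v - lookup D' v = laplacian G k v)"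

lemma lin_equiv_refl: "lin_equiv D D"
  unfolding lin_equiv_def by (intro exI[of _ "\<lambda>_. 0"]) (simp add: laplacian_def)

lemma lin_equiv_sym: "lin_equiv D D' \<Longrightarrow> lin_equiv D' D"
  unfolding lin_equiv_def
proof (elim exE)
  fix k assume "\<forall>v\<in>verts G. lookup D v - lookup D' v = laplacian G k v"
  then show "\<exists>k. \<forall>v\<in>verts G. lookup D' v - lookup D v = laplacian G k v"
    by (intro exI[of _ "\<lambda>v. - k v"]) (simp add: laplacian_minus flip: minus_diff_eq[of "lookup D _" "lookup D' _"])
qed

lemma lin_equiv_trans: "lin_equiv D D' \<Longrightarrow> lin_equiv D' D'' \<Longrightarrow> lin_equiv D D''"
  unfolding lin_equiv_def
proof (elim exE)
  fix k k' assume "\<forall>v\<in>verts G. lookup D v - lookup D' v = laplacian G k v"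
    "\<forall>v\<in>verts G. lookup D' v - lookup D'' v = laplacian G k' v"
  then show "\<exists>k. \<forall>v\<in>verts G. lookup D v - lookup D'' v = laplacian G k v"
    by (intro exI[of _ "\<lambda>v. k v + k' v"]) (auto simp: laplacian_add dest!: bspec)
qed

lemma Div0_iff: "D \<in> carrier (Div0 G) \<longleftrightarrow> keys D \<subseteq> verts G \<and> (\<Sum>v\<in>verts G. lookup D v) = 0"
proof -
  have "divisor_degree D = (\<Sum>v\<in>verts G. lookup D v)" if "keys D \<subseteq> verts G"
    unfolding divisor_degree_def using that
    by (intro sum.mono_neutral_left) (auto simp: in_keys_iff)
  then show ?thesis unfolding Div0_def by auto
qed

lemma mult_Div0 [simp]: "x \<otimes>\<^bsub>Div0 G\<^esub> y = x + y"
  by (simp add: Div0_def)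

lemma one_Div0 [simp]: "\<one>\<^bsub>Div0 G\<^esub> = 0"
  by (simp add: Div0_def)

lemma Div0_add: "x \<in> carrier (Div0 G) \<Longrightarrow> y \<in> carrier (Div0 G) \<Longrightarrow> x + y \<in> carrier (Div0 G)"
  unfolding Div0_iff using keys_add[of x y] by (auto simp: lookup_add sum.distrib)

lemma Div0_uminus: "x \<in> carrier (Div0 G) \<Longrightarrow> - x \<in> carrier (Div0 G)"
  unfolding Div0_iff by (auto simp: sum_negf)

lemma Div0_diff: "x \<in> carrier (Div0 G) \<Longrightarrow> y \<in> carrier (Div0 G) \<Longrightarrow> x - y \<in> carrier (Div0 G)"
  using Div0_add[OF _ Div0_uminus] by fastforce

lemma group_Div0: "group (Div0 G)"
proof (rule groupI)
  show "\<exists>y\<in>carrier (Div0 G). y \<otimes>\<^bsub>Div0 G\<^esub> x = \<one>\<^bsub>Div0 G\<^esub>" if "x \<in> carrier (Div0 G)" for x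
    using Div0_uminus[OF that] by (intro bexI[of _ "- x"]) auto
qed (auto simp: Div0_add, auto simp: Div0_iff)

lemma inv_Div0: "x \<in> carrier (Div0 G) \<Longrightarrow> inv\<^bsub>Div0 G\<^esub> x = - x"
  by (rule group.inv_equality[OF group_Div0]) (auto simp: Div0_uminus)

text \<open>The Laplacian is symmetric: \<open>rv\<close> matches the arcs from \<open>u\<close> to
  \<open>v\<close> with those from \<open>v\<close> to \<open>u\<close>, so a lending move, which is
  a column of the Laplacian matrix, can be read off its rows.\<close>

lemma lookup_lending:
  assumes "u \<in> verts G"
  shows "lookup (lending G u) v = laplacian G (\<lambda>w. if w = u then 1 else 0) v"
proof -
  have "lookup (lending G u) v = (\<Sum>a\<in>out_arcs G u. if head G a = v then 1 else 0)
      - (if v = u then int (card (out_arcs G u)) else 0)"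
    by (auto simp: lending_def lookup_minus lookup_sum out_degree_def intro!: sum.cong)
  moreover have "(\<Sum>a\<in>out_arcs G u. if head G a = v then 1 else 0 :: int)
      = (\<Sum>a\<in>out_arcs G v. if head G a = u then 1 else 0)"
  proof -
    have "(\<Sum>a\<in>out_arcs G u. if head G a = v then 1 else 0 :: int) = (\<Sum>a\<in>{a \<in> arcs G. tail G a = u \<and> head G a = v}. 1)"
      by (subst sum.inter_filter[symmetric]) (auto intro!: sum.cong)
    also have "\<dots> = (\<Sum>a\<in>{a \<in> arcs G. tail G a = v \<and> head G a = u}. 1)"
      by (rule sum.reindex_bij_witness[of _ rv rv]) auto
    also have "\<dots> = (\<Sum>a\<in>out_arcs G v. if head G a = u then 1 else 0)"
      by (subst sum.inter_filter[symmetric]) (auto intro!: sum.cong)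
    finally show ?thesis .
  qed
  ultimately show ?thesis
    by (auto simp: laplacian_def sum_subtractf)
qed

lemma lookup_partial_sum_lending:
  assumes "finite V" "V \<subseteq> verts G"
  shows "lookup (\<Sum>u\<in>V. frag_cmul (k u) (lending G u)) v = laplacian G (\<lambda>w. if w \<in> V then k w else 0) v"
  using assms
proof (induction V)
  case empty
  then show ?case by (simp add: laplacian_def)
next
  case (insert u V)
  have "laplacian G (\<lambda>w. if w \<in> insert u V then k w else 0) v
      = laplacian G (\<lambda>w. k u * (if w = u then 1 else 0) + (if w \<in> V then k w else 0)) v"
    using insert(2) by (intro arg_cong[of _ _ "\<lambda>f. laplacian G f v"]) auto
  also have "\<dots> = k u * laplacian G (\<lambda>w. if w = u then 1 else 0) v
      + laplacian G (\<lambda>w. if w \<in> V then k w else 0) v"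
    unfolding laplacian_add by (simp add: laplacian_def sum_distrib_left right_diff_distrib)
  finally show ?case using insert by (simp add: lookup_add lookup_lending)
qed

lemma lookup_sum_lending:
  assumes "v \<in> verts G"
  shows "lookup (\<Sum>u\<in>verts G. frag_cmul (k u) (lending G u)) v = laplacian G k v"
proof -
  have "laplacian G (\<lambda>w. if w \<in> verts G then k w else 0) v = laplacian G k v"
    unfolding laplacian_def using assms by (intro sum.cong) auto
  then show ?thesis by (simp add: lookup_partial_sum_lending)
qed

lemma sum_laplacian: "(\<Sum>v\<in>verts G. laplacian G k v) = 0"
  using sum_outflow[OF skew_grad, of k] by (simp add: outflow_grad sum_negf)

lemma keys_lending: "u \<in> verts G \<Longrightarrow> keys (lending G u) \<subseteq> verts G"
  unfolding lending_def
  by (rule order_trans[OF keys_diff] Un_least order_trans[OF keys_sum])+ (auto simp: keys_frag_of)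

lemma lending_Div0: "u \<in> verts G \<Longrightarrow> lending G u \<in> carrier (Div0 G)"
  unfolding Div0_iff using keys_lending by (simp add: lookup_lending sum_laplacian)

text \<open>The generated subgroup is the image of the Laplacian. A potential \<open>k\<close> is
  turned back into a combination of lending moves with coefficients \<open>k u\<close>; both
  divisors vanish outside the vertex set.\<close>

lemma principal_divisors_iff:
  "P \<in> principal_divisors G \<longleftrightarrow> P \<in> carrier (Div0 G) \<and> lin_equiv P 0"
proof
  assume "P \<in> principal_divisors G"
  then show "P \<in> carrier (Div0 G) \<and> lin_equiv P 0"
    unfolding principal_divisors_def
  proof induction
    case one
    then show ?case using lin_equiv_refl by (simp add: Div0_iff)
  next
    case (incl h)
    then show ?case using lending_Div0 by (auto simp: lin_equiv_def lookup_lending)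
  next
    case (inv h)
    then obtain u where u: "u \<in> verts G" "h = lending G u" by blast
    have "laplacian G (\<lambda>w. - (if w = u then 1 else 0)) v = - lookup h v" for v
      using u by (simp only: laplacian_minus lookup_lending)
    then have "lin_equiv (- h) 0" unfolding lin_equiv_def
      by (intro exI[of _ "\<lambda>w. - (if w = u then 1 else 0)"]) (simp only: lookup_uminus lookup_zero, simp)
    then show ?case using lending_Div0[OF u(1)] u by (simp add: inv_Div0 Div0_uminus)
  next
    case (eng h1 h2)
    then obtain k1 k2 where "\<forall>v\<in>verts G. lookup h1 v = laplacian G k1 v" "\<forall>v\<in>verts G. lookup h2 v = laplacian G k2 v"
      unfolding lin_equiv_def by auto
    then have "lin_equiv (h1 + h2) 0"
      unfolding lin_equiv_def by (intro exI[of _ "\<lambda>v. k1 v + k2 v"]) (auto simp: laplacian_add lookup_add)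
    then show ?case using eng Div0_add by simp
  qed
next
  assume P: "P \<in> carrier (Div0 G) \<and> lin_equiv P 0"
  then obtain k where k: "\<And>v. v \<in> verts G \<Longrightarrow> lookup P v = laplacian G k v"
    unfolding lin_equiv_def by auto
  have sub: "subgroup (principal_divisors G) (Div0 G)"
    unfolding principal_divisors_def
    by (rule group.generate_is_subgroup[OF group_Div0]) (auto simp: lending_Div0)
  have add: "x + y \<in> principal_divisors G" if "x \<in> principal_divisors G" "y \<in> principal_divisors G" for x y
    using subgroup.m_closed[OF sub that] by simp
  have uminus: "- x \<in> principal_divisors G" if "x \<in> principal_divisors G" for x
    using subgroup.m_inv_closed[OF sub that] subgroup.mem_carrier[OF sub that] by (simp add: inv_Div0)
  have zero: "0 \<in> principal_divisors G" using subgroup.one_closed[OF sub] by simp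
  have lend: "lending G u \<in> principal_divisors G" if "u \<in> verts G" for u
    unfolding principal_divisors_def using that by (intro generate.incl) blast
  define P' where "P' = (\<Sum>u\<in>verts G. frag_cmul (k u) (lending G u))"
  have P'_mem: "P' \<in> principal_divisors G"
    unfolding P'_def by (intro additive_closed[OF zero add uminus] lend)
  have "lookup P v = lookup P' v" for v
  proof (cases "v \<in> verts G")
    case True
    then show ?thesis using k[OF True] unfolding P'_def by (simp add: lookup_sum_lending)
  next
    case False
    then have "v \<notin> keys P" "v \<notin> keys P'"
      using P subgroup.mem_carrier[OF sub P'_mem] unfolding Div0_iff by blast+
    then show ?thesis by (simp add: in_keys_iff)
  qed
  then have "P = P'" by (rule poly_mapping_eqI)
  then show "P \<in> principal_divisors G" using P'_mem by simp
qed

lemma mem_divisor_class: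
  assumes "D \<in> carrier (Div0 G)"
  shows "E \<in> divisor_class G D \<longleftrightarrow> E \<in> carrier (Div0 G) \<and> lin_equiv E D"
proof -
  have "lin_equiv E D \<longleftrightarrow> lin_equiv (E - D) 0"
    unfolding lin_equiv_def by (simp add: lookup_minus)
  moreover have "E \<in> divisor_class G D \<longleftrightarrow> E - D \<in> principal_divisors G"
    unfolding divisor_class_def r_coset_def by (auto, metis diff_add_cancel)
  moreover have "E - D \<in> carrier (Div0 G) \<longleftrightarrow> E \<in> carrier (Div0 G)"
    using Div0_diff[OF _ assms, of E] Div0_add[OF _ assms, of "E - D"] by auto
  ultimately show ?thesis by (simp add: principal_divisors_iff)
qed

lemma divisor_class_eq_iff:
  assumes "D \<in> carrier (Div0 G)" "E \<in> carrier (Div0 G)"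
  shows "divisor_class G D = divisor_class G E \<longleftrightarrow> lin_equiv D E"
  using mem_divisor_class[OF assms(1)] mem_divisor_class[OF assms(2)] assms
    lin_equiv_refl lin_equiv_sym lin_equiv_trans by blast

lemma carrier_Jac: "carrier (Jac G) = divisor_class G ` carrier (Div0 G)"
  unfolding Jac_def FactGroup_def RCOSETS_def divisor_class_def by auto

lemma Jac_class:
  assumes "x \<in> carrier (Jac G)" "D \<in> x"
  shows "D \<in> carrier (Div0 G)" "x = divisor_class G D"
proof -
  obtain E where E: "E \<in> carrier (Div0 G)" "x = divisor_class G E"
    using assms(1) unfolding carrier_Jac by blast
  then show D: "D \<in> carrier (Div0 G)" using assms(2) mem_divisor_class by blast
  show "x = divisor_class G D"
    using E D assms(2) mem_divisor_class divisor_class_eq_iff lin_equiv_sym by metis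
qed

lemma self_mem_divisor_class: "D \<in> carrier (Div0 G) \<Longrightarrow> D \<in> divisor_class G D"
  by (simp add: mem_divisor_class lin_equiv_refl)

text \<open>The lending moves that \<open>laplacian_dominates\<close> gives for the demand
  \<open>- E\<close> pay off every debt away from \<open>q\<close>.\<close>

lemma Jac_effective_off:
  assumes x: "x \<in> carrier (Jac G)" and q: "q \<in> verts G"
  obtains D where "D \<in> x" "\<And>v. v \<in> verts G \<Longrightarrow> v \<noteq> q \<Longrightarrow> 0 \<le> lookup D v"
proof -
  obtain E where E: "E \<in> carrier (Div0 G)" "x = divisor_class G E"
    using x unfolding carrier_Jac by blast
  obtain k where k: "\<And>v. v \<in> verts G \<Longrightarrow> v \<noteq> q \<Longrightarrow> - lookup E v \<le> laplacian G k v"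
    using laplacian_dominates[OF q, of "\<lambda>v. - lookup E v"] by blast
  define P where "P = (\<Sum>u\<in>verts G. frag_cmul (k u) (lending G u))"
  have lookP: "lookup P v = laplacian G k v" if "v \<in> verts G" for v
    unfolding P_def by (rule lookup_sum_lending[OF that])
  have "keys P \<subseteq> verts G"
    unfolding P_def using keys_lending keys_cmul
    by (intro order_trans[OF keys_sum] UN_least) blast
  then have "P \<in> carrier (Div0 G)"
    unfolding Div0_iff by (simp add: lookP sum_laplacian)
  then have "E + P \<in> x"
    unfolding E(2) mem_divisor_class[OF E(1)] using E(1) lookP
    by (auto simp: Div0_add lin_equiv_def lookup_add)
  moreover have "0 \<le> lookup (E + P) v" if "v \<in> verts G" "v \<noteq> q" for v
    using k[OF that] lookP[OF that(1)] by (simp add: lookup_add)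
  ultimately show thesis using that by blast
qed

end

section \<open>Chains, cycles and cuts\<close>

text \<open>The flow on all arcs that a chain on the reference orientation \<open>\<omega>\<close>
  stands for. For chains supported in \<open>\<omega>\<close> this is a bijection onto skew
  functions on arcs, so chains can be treated as flows.\<close>

definition net_flow :: "('b \<Rightarrow> 'b) \<Rightarrow> 'b set \<Rightarrow> ('b \<Rightarrow>\<^sub>0 int) \<Rightarrow> 'b \<Rightarrow> int" where
  "net_flow rv \<omega> c a = (if a \<in> \<omega> then lookup c a else - lookup c (rv a))"

lemma net_flow_add: "net_flow rv \<omega> (c + c') a = net_flow rv \<omega> c a + net_flow rv \<omega> c' a"
  by (simp add: net_flow_def lookup_add)

lemma net_flow_uminus: "net_flow rv \<omega> (- c) a = - net_flow rv \<omega> c a"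
  by (simp add: net_flow_def)

lemma net_flow_diff: "net_flow rv \<omega> (c - c') a = net_flow rv \<omega> c a - net_flow rv \<omega> c' a"
  by (simp add: net_flow_def lookup_minus)

lemma net_flow_cmul: "net_flow rv \<omega> (frag_cmul n c) a = n * net_flow rv \<omega> c a"
  by (simp add: net_flow_def)

lemma net_flow_sum: "net_flow rv \<omega> (\<Sum>i\<in>I. f i) a = (\<Sum>i\<in>I. net_flow rv \<omega> (f i) a)"
  by (simp add: net_flow_def lookup_sum sum_negf)

lemma generate_free_Abelian_group_closed:
  assumes X: "X \<subseteq> carrier (free_Abelian_group S)"
  defines "H \<equiv> generate (free_Abelian_group S) X"
  shows "c \<in> H \<Longrightarrow> keys c \<subseteq> S" "0 \<in> H" "c \<in> H \<Longrightarrow> c' \<in> H \<Longrightarrow> c + c' \<in> H"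
    "c \<in> H \<Longrightarrow> - c \<in> H" "c \<in> H \<Longrightarrow> frag_cmul n c \<in> H"
    "(\<And>i. i \<in> I \<Longrightarrow> f i \<in> H) \<Longrightarrow> sum f I \<in> H"
proof -
  have sub: "subgroup H (free_Abelian_group S)"
    unfolding H_def by (rule group.generate_is_subgroup[OF group_free_Abelian_group X])
  show keys: "c \<in> H \<Longrightarrow> keys c \<subseteq> S" for c using subgroup.mem_carrier[OF sub] by fastforce
  show zero: "0 \<in> H" using subgroup.one_closed[OF sub] by simp
  show add: "c \<in> H \<Longrightarrow> c' \<in> H \<Longrightarrow> c + c' \<in> H" for c c'
    using subgroup.m_closed[OF sub] by fastforce
  show uminus: "c \<in> H \<Longrightarrow> - c \<in> H" for c
    using subgroup.m_inv_closed[OF sub, of c] keys[of c] by simp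
  show "c \<in> H \<Longrightarrow> frag_cmul n c \<in> H" "(\<And>i. i \<in> I \<Longrightarrow> f i \<in> H) \<Longrightarrow> sum f I \<in> H"
    by (rule additive_closed[OF zero add uminus]; assumption)+
qed

section \<open>Chains as skew flows\<close>

context connected_multigraph
begin

context
  fixes \<omega> assumes orient: "orientation G rv \<omega>"
begin

lemma orientationD: "a \<in> \<omega> \<Longrightarrow> a \<in> arcs G" "a \<in> arcs G \<Longrightarrow> rv a \<in> \<omega> \<longleftrightarrow> a \<notin> \<omega>"
  using orient unfolding orientation_def by blast+

lemma finite_orientation: "finite \<omega>"
  using orientationD(1) finite_subset[OF _ finite_arcs] by blast

lemma skew_net_flow: "skew G rv (net_flow rv \<omega> c)"
  unfolding skew_def net_flow_def by (auto simp: orientationD)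

lemma net_flow_inject:
  assumes "keys c \<subseteq> \<omega>" "keys c' \<subseteq> \<omega>" "\<And>a. a \<in> arcs G \<Longrightarrow> net_flow rv \<omega> c a = net_flow rv \<omega> c' a"
  shows "c = c'"
proof (rule poly_mapping_eqI)
  fix a
  show "lookup c a = lookup c' a"
  proof (cases "a \<in> \<omega>")
    case True
    then show ?thesis using assms(3)[OF orientationD(1)] by (simp add: net_flow_def)
  next
    case False
    then have "a \<notin> keys c" "a \<notin> keys c'" using assms by auto
    then show ?thesis by (simp add: in_keys_iff)
  qed
qed

lemma net_flow_surj:
  assumes z: "skew G rv z"
  obtains c where "keys c \<subseteq> \<omega>" "\<And>a. a \<in> arcs G \<Longrightarrow> net_flow rv \<omega> c a = z a"
proof -
  define c where "c = (\<Sum>b\<in>\<omega>. frag_cmul (z b) (frag_of b))"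
  have look: "lookup c a = (if a \<in> \<omega> then z a else 0)" for a
    unfolding c_def using finite_orientation by (simp add: lookup_sum if_distrib[of "\<lambda>x. z _ * x"] cong: if_cong)
  have "keys c \<subseteq> \<omega>" by (auto simp: in_keys_iff look split: if_splits)
  moreover have "net_flow rv \<omega> c a = z a" if "a \<in> arcs G" for a
    using that skewD[OF z that] by (auto simp: net_flow_def look orientationD)
  ultimately show thesis using that by blast
qed

text \<open>An arc of \<open>\<omega>\<close> entering \<open>v\<close> is accounted for by its
  reversal, which leaves \<open>v\<close>. The sign is there because \<open>boundary\<close> counts
  heads positively and outflow counts tails.\<close>

lemma lookup_boundary:
  assumes "keys c \<subseteq> \<omega>"
  shows "lookup (boundary G c) v = - outflow G (net_flow rv \<omega> c) v"
proof -
  define f where "f = (\<lambda>a. lookup c a * ((if head G a = v then 1 else 0) - (if tail G a = v then 1 else 0)))"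
  have "lookup (boundary G c) v = (\<Sum>a\<in>keys c. f a)"
    unfolding boundary_def frag_extend_def f_def by (simp add: lookup_sum lookup_minus eq_commute[of v])
  also have "\<dots> = (\<Sum>a\<in>\<omega>. f a)"
    using assms finite_orientation by (intro sum.mono_neutral_left) (auto simp: f_def in_keys_iff)
  also have "\<dots> = (\<Sum>a\<in>\<omega>. if head G a = v then lookup c a else 0) - (\<Sum>a\<in>\<omega>. if tail G a = v then lookup c a else 0)"
    unfolding f_def sum_subtractf[symmetric] by (intro sum.cong) auto
  also have "(\<Sum>a\<in>\<omega>. if tail G a = v then lookup c a else 0) = (\<Sum>a\<in>out_arcs G v \<inter> \<omega>. lookup c a)"
    using finite_orientation orientationD(1) by (subst sum.inter_filter[symmetric]) (auto intro!: sum.cong)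
  also have "(\<Sum>a\<in>\<omega>. if head G a = v then lookup c a else 0) = (\<Sum>a\<in>out_arcs G v - \<omega>. lookup c (rv a))"
    using finite_orientation orientationD
    by (subst sum.inter_filter[symmetric]) (auto intro!: sum.reindex_bij_witness[of _ rv rv])
  also have "(\<Sum>a\<in>out_arcs G v - \<omega>. lookup c (rv a)) - (\<Sum>a\<in>out_arcs G v \<inter> \<omega>. lookup c a)
      = - outflow G (net_flow rv \<omega> c) v"
    unfolding outflow_def net_flow_def
    by (subst sum.Int_Diff[of _ _ \<omega>]) (auto simp: sum_negf)
  finally show ?thesis .
qed

lemma boundary_Div0:
  assumes "keys c \<subseteq> \<omega>"
  shows "boundary G c \<in> carrier (Div0 G)"
proof -
  have "keys (boundary G c) \<subseteq> (\<Union>a\<in>keys c. keys (frag_of (head G a) - frag_of (tail G a)))"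
    unfolding boundary_def by (rule keys_frag_extend)
  also have "\<dots> \<subseteq> verts G"
  proof (intro UN_least order_trans[OF keys_diff])
    fix a assume "a \<in> keys c"
    then have "a \<in> arcs G" using assms orientationD by blast
    then show "keys (frag_of (head G a)) \<union> keys (frag_of (tail G a)) \<subseteq> verts G" by simp
  qed
  finally show ?thesis
    unfolding Div0_iff using sum_outflow[OF skew_net_flow] by (simp add: lookup_boundary[OF assms] sum_negf)
qed

section \<open>Cycles are circulations, cuts are gradients\<close>

lemma keys_chain_of_arc: "a \<in> arcs G \<Longrightarrow> keys (chain_of_arc rv \<omega> a) \<subseteq> \<omega>"
  by (auto simp: chain_of_arc_def orientationD)

lemma net_flow_chain_of_arc:
  assumes "a \<in> arcs G"
  shows "net_flow rv \<omega> (chain_of_arc rv \<omega> a) b = (if b = a then 1 else 0) - (if rv b = a then 1 else 0)"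
proof -
  consider "b = a" | "b = rv a" | "b \<noteq> a" "rv b \<noteq> a" "b \<noteq> rv a" "rv b \<noteq> rv a"
    by (metis arev_arev)
  then show ?thesis
    using arev_neq[OF assms] orientationD(2)[OF assms]
    by cases (simp_all add: net_flow_def chain_of_arc_def)
qed

lemma keys_sum_chain: "(\<And>a. a \<in> S \<Longrightarrow> a \<in> arcs G) \<Longrightarrow> keys (\<Sum>a\<in>S. chain_of_arc rv \<omega> a) \<subseteq> \<omega>"
  using keys_chain_of_arc by (intro order_trans[OF keys_sum] UN_least) blast

lemma outflow_chain:
  assumes "a \<in> arcs G"
  shows "outflow G (net_flow rv \<omega> (chain_of_arc rv \<omega> a)) v
    = (if tail G a = v then 1 else 0) - (if head G a = v then 1 else 0)"
proof -
  have "rv b = a \<longleftrightarrow> b = rv a" for b by auto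
  then show ?thesis
    unfolding outflow_def net_flow_chain_of_arc[OF assms] using assms
    by (simp add: sum_subtractf finite_out_arcs)
qed

text \<open>The contributions of the arcs telescope along the closed walk; since its arcs are
  distinct, the sum over the set is the sum over the list.\<close>

lemma outflow_cycle:
  assumes p: "cycle p"
  shows "outflow G (net_flow rv \<omega> (\<Sum>a\<in>set p. chain_of_arc rv \<omega> a)) v = 0"
proof -
  obtain u where u: "awalk u p u" "distinct p" using p unfolding cycle_conv by blast
  have tele: "awalk u p w \<Longrightarrow> (\<Sum>a\<leftarrow>p. (if tail G a = v then 1 else 0) - (if head G a = v then 1 else 0 :: int))
      = (if u = v then 1 else 0) - (if w = v then 1 else 0)" for u w p
    by (induction p arbitrary: u) (auto simp: awalk_simps)
  have "outflow G (net_flow rv \<omega> (\<Sum>a\<in>set p. chain_of_arc rv \<omega> a)) v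
      = (\<Sum>a\<in>set p. outflow G (net_flow rv \<omega> (chain_of_arc rv \<omega> a)) v)"
    unfolding outflow_def net_flow_sum by (rule sum.swap)
  also have "\<dots> = (\<Sum>a\<in>set p. (if tail G a = v then 1 else 0) - (if head G a = v then 1 else 0))"
    using u(1) by (intro sum.cong outflow_chain) auto
  also have "\<dots> = 0"
    using tele[OF u(1)] u(2) by (simp add: sum.distinct_set_conv_list)
  finally show ?thesis .
qed

lemma cycle_arcs: "cycle p \<Longrightarrow> a \<in> set p \<Longrightarrow> a \<in> arcs G"
  unfolding cycle_def by auto

lemma cycle_chains:
  "{(\<Sum>a\<in>set p. chain_of_arc rv \<omega> a) |p. cycle p} \<subseteq> carrier (free_Abelian_group \<omega>)"
  by (clarify, unfold carrier_free_Abelian_group_iff, rule keys_sum_chain) (auto intro: cycle_arcs)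

lemma cut_chains:
  "{(\<Sum>a\<in>{a \<in> arcs G. tail G a \<in> U \<and> head G a \<notin> U}. chain_of_arc rv \<omega> a) |U. U \<subseteq> verts G}
    \<subseteq> carrier (free_Abelian_group \<omega>)"
  by (clarify, unfold carrier_free_Abelian_group_iff, rule keys_sum_chain) auto

text \<open>The fundamental cycles of a spanning tree generate all circulations. Subtracting from
  \<open>c\<close> the combination with coefficients \<open>lookup c a\<close>, for \<open>a\<close>
  outside the tree, leaves a circulation supported on the tree, which vanishes.\<close>

lemma cycle_lattice_iff:
  "c \<in> cycle_lattice G rv \<omega> \<longleftrightarrow> keys c \<subseteq> \<omega> \<and> (\<forall>v\<in>verts G. outflow G (net_flow rv \<omega> c) v = 0)"
proof -
  let ?X = "{(\<Sum>a\<in>set p. chain_of_arc rv \<omega> a) |p. cycle p}"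
  have X: "?X \<subseteq> carrier (free_Abelian_group \<omega>)"
    by (rule cycle_chains)
  note closed = generate_free_Abelian_group_closed[OF X, folded cycle_lattice_def]
  show ?thesis
  proof
    assume c: "c \<in> cycle_lattice G rv \<omega>"
    have "outflow G (net_flow rv \<omega> c) v = 0" for v
      using c unfolding cycle_lattice_def
    proof induction
      case one
      then show ?case by (auto simp: outflow_def net_flow_def intro!: sum.neutral)
    next
      case (incl h)
      then show ?case using outflow_cycle by blast
    next
      case (inv h)
      have "h \<in> carrier (free_Abelian_group \<omega>)" using inv X by (rule subsetD[rotated])
      moreover have "outflow G (net_flow rv \<omega> h) v = 0" using inv outflow_cycle by blast
      ultimately show ?case by (simp add: outflow_def net_flow_uminus sum_negf)
    next
      case (eng h1 h2)
      then show ?case by (simp add: net_flow_add[abs_def] outflow_add)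
    qed
    then show "keys c \<subseteq> \<omega> \<and> (\<forall>v\<in>verts G. outflow G (net_flow rv \<omega> c) v = 0)"
      using closed(1)[OF c] by blast
  next
    assume c: "keys c \<subseteq> \<omega> \<and> (\<forall>v\<in>verts G. outflow G (net_flow rv \<omega> c) v = 0)"
    obtain q where q: "q \<in> verts G" using verts_nonempty by blast
    obtain \<rho> d where r: "rooted q \<rho> d" using rooted_exists[OF q] .
    define T where "T = tree_arcs q \<rho>"
    note T = tree_arcs_subset[OF r, folded T_def] rv_tree_arcs[of q \<rho>, folded T_def]
      connected_tree_arcs[OF r, folded T_def]
    have "\<exists>p. set p \<subseteq> T \<and> cycle (a # p)" if "a \<in> \<omega> - T" for a
    proof (rule fundamental_cycle[OF T])
      show "a \<in> arcs G" "a \<notin> T" using \<open>a \<in> \<omega> - T\<close> orientationD(1) by auto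
    qed blast
    then obtain p where p: "\<And>a. a \<in> \<omega> - T \<Longrightarrow> set (p a) \<subseteq> T \<and> cycle (a # p a)"
      by metis
    define C where "C = (\<lambda>a. \<Sum>b\<in>set (a # p a). chain_of_arc rv \<omega> b)"
    have C: "C a \<in> cycle_lattice G rv \<omega>" if "a \<in> \<omega> - T" for a
      unfolding cycle_lattice_def C_def using p[OF that] by (intro generate.incl) blast
    define c' where "c' = (\<Sum>a\<in>\<omega> - T. frag_cmul (lookup c a) (C a))"
    have c': "c' \<in> cycle_lattice G rv \<omega>"
      unfolding c'_def by (intro closed(5,6) C)
    have outC: "outflow G (net_flow rv \<omega> (C a)) v = 0" if "a \<in> \<omega> - T" for a v
      unfolding C_def using outflow_cycle p[OF that] by blast
    have outc': "outflow G (net_flow rv \<omega> c') v = 0" for v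
    proof -
      have "outflow G (net_flow rv \<omega> c') v = (\<Sum>a\<in>\<omega> - T. lookup c a * outflow G (net_flow rv \<omega> (C a)) v)"
        unfolding c'_def outflow_def net_flow_sum net_flow_cmul sum_distrib_left by (rule sum.swap)
      then show ?thesis using outC by simp
    qed
    \<comment> \<open>Apart from \<open>a\<close>, the fundamental cycle of \<open>a\<close> runs
      inside \<open>T\<close>, so that off the tree the coefficients can be chosen
      independently.\<close>
    have netC: "net_flow rv \<omega> (C a) b = (if b = a then 1 else 0)" if a: "a \<in> \<omega> - T" and b: "b \<in> \<omega> - T" for a b
    proof -
      have rb: "rv b \<notin> T" using b T(2) by (metis DiffD2 arev_arev imageI)
      have rba: "rv b \<noteq> a" using a b orientationD by blast
      have "net_flow rv \<omega> (C a) b = (\<Sum>e\<in>set (a # p a). (if b = e then 1 else 0) - (if rv b = e then 1 else 0))"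
        unfolding C_def net_flow_sum using p[OF a] cycle_arcs by (intro sum.cong net_flow_chain_of_arc) auto
      also have "\<dots> = (if b \<in> set (a # p a) then 1 else 0) - (if rv b \<in> set (a # p a) then 1 else 0)"
        unfolding sum_subtractf by (simp only: sum.delta'[OF finite_set])
      also have "\<dots> = (if b = a then 1 else 0)"
        using p[OF a] rb rba b by auto
      finally show ?thesis .
    qed
    define y where "y = net_flow rv \<omega> (c - c')"
    have y0: "y a = 0" if a: "a \<in> arcs G" for a
    proof (rule tree_flow_zero[OF r _ _ _ a])
      show y: "skew G rv y" unfolding y_def by (rule skew_net_flow)
      show "outflow G y v = 0" if "v \<in> verts G" for v
        unfolding y_def net_flow_diff[abs_def] outflow_diff using c outc' that by simp
      have in_omega: "y b = 0" if b: "b \<in> \<omega> - T" for b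
      proof -
        have "net_flow rv \<omega> c' b = (\<Sum>a\<in>\<omega> - T. lookup c a * (if b = a then 1 else 0))"
          unfolding c'_def net_flow_sum net_flow_cmul using netC[OF _ b] by (intro sum.cong) auto
        also have "\<dots> = lookup c b"
          using b finite_orientation by (simp add: if_distrib cong: if_cong)
        finally show ?thesis using b by (simp add: y_def net_flow_diff net_flow_def[of _ _ c])
      qed
      fix b assume b: "b \<in> arcs G" "b \<notin> tree_arcs q \<rho>"
      show "y b = 0"
      proof (cases "b \<in> \<omega>")
        case True
        then show ?thesis using in_omega b unfolding T_def by blast
      next
        case False
        have "rv b \<notin> T" using b(2) T(2) unfolding T_def by (metis arev_arev imageI)
        then have "y (rv b) = 0" using in_omega False orientationD(2)[OF b(1)] by blast
        then show ?thesis using skewD[OF y b(1)] by simp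
      qed
    qed
    have "c = c'"
      using y0 c closed(1)[OF c'] unfolding y_def net_flow_diff by (intro net_flow_inject) auto
    then show "c \<in> cycle_lattice G rv \<omega>" using c' by simp
  qed
qed

text \<open>A cut is the gradient of the indicator function of \<open>U\<close>, and the gradient of
  \<open>g\<close> is the combination of the cuts around single vertices \<open>v\<close> with
  coefficients \<open>g v\<close>.\<close>

lemma cut_lattice_iff:
  "c \<in> cut_lattice G rv \<omega> \<longleftrightarrow> keys c \<subseteq> \<omega> \<and> (\<exists>g. \<forall>a\<in>arcs G. net_flow rv \<omega> c a = grad G g a)"
proof -
  define cut where "cut = (\<lambda>U. \<Sum>a\<in>{a \<in> arcs G. tail G a \<in> U \<and> head G a \<notin> U}. chain_of_arc rv \<omega> a)"
  let ?X = "{cut U |U. U \<subseteq> verts G}"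
  have X: "?X \<subseteq> carrier (free_Abelian_group \<omega>)"
    unfolding cut_def by (rule cut_chains)
  note closed = generate_free_Abelian_group_closed[OF X, unfolded cut_def, folded cut_lattice_def, folded cut_def]
  have net_cut: "net_flow rv \<omega> (cut U) b = grad G (\<lambda>v. if v \<in> U then 1 else 0) b" if b: "b \<in> arcs G" for U b
  proof -
    let ?S = "{a \<in> arcs G. tail G a \<in> U \<and> head G a \<notin> U}"
    have "net_flow rv \<omega> (cut U) b = (\<Sum>a\<in>?S. (if b = a then 1 else 0) - (if rv b = a then 1 else 0))"
      unfolding cut_def net_flow_sum by (intro sum.cong net_flow_chain_of_arc) auto
    also have "\<dots> = (if b \<in> ?S then 1 else 0) - (if rv b \<in> ?S then 1 else 0)"
      unfolding sum_subtractf by (simp only: sum.delta' finite_arcs finite_Collect_conjI disjI1 Collect_mem_eq)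
    also have "\<dots> = grad G (\<lambda>v. if v \<in> U then 1 else 0) b"
      using b by (auto simp: grad_def)
    finally show ?thesis .
  qed
  show ?thesis
  proof
    assume c: "c \<in> cut_lattice G rv \<omega>"
    have "\<exists>g. \<forall>a\<in>arcs G. net_flow rv \<omega> c a = grad G g a"
      using c unfolding cut_lattice_def cut_def[symmetric]
    proof induction
      case one
      then show ?case by (intro exI[of _ "\<lambda>_. 0"]) (simp add: net_flow_def grad_def)
    next
      case (incl h)
      then obtain U where "h = cut U" unfolding cut_def by blast
      then show ?case using net_cut[of _ U] by blast
    next
      case (inv h)
      then obtain U where "h = cut U" unfolding cut_def by blast
      moreover have "h \<in> carrier (free_Abelian_group \<omega>)" using inv cut_chains by (rule subsetD[rotated])
      ultimately show ?case
        using net_cut[of _ U] by (intro exI[of _ "\<lambda>v. - (if v \<in> U then 1 else 0)"]) (simp add: net_flow_uminus grad_def)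
    next
      case (eng h1 h2)
      then obtain g1 g2 where "\<forall>a\<in>arcs G. net_flow rv \<omega> h1 a = grad G g1 a" "\<forall>a\<in>arcs G. net_flow rv \<omega> h2 a = grad G g2 a"
        by blast
      then show ?case by (intro exI[of _ "\<lambda>v. g1 v + g2 v"]) (simp add: net_flow_add grad_def)
    qed
    then show "keys c \<subseteq> \<omega> \<and> (\<exists>g. \<forall>a\<in>arcs G. net_flow rv \<omega> c a = grad G g a)"
      using closed(1)[OF c] by blast
  next
    assume c: "keys c \<subseteq> \<omega> \<and> (\<exists>g. \<forall>a\<in>arcs G. net_flow rv \<omega> c a = grad G g a)"
    then obtain g where g: "\<And>a. a \<in> arcs G \<Longrightarrow> net_flow rv \<omega> c a = grad G g a" by blast
    define c' where "c' = (\<Sum>v\<in>verts G. frag_cmul (g v) (cut {v}))"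
    have "cut {v} \<in> cut_lattice G rv \<omega>" if "v \<in> verts G" for v
      unfolding cut_lattice_def cut_def using that by (intro generate.incl) blast
    then have c': "c' \<in> cut_lattice G rv \<omega>"
      unfolding c'_def by (intro closed(5,6))
    have "net_flow rv \<omega> c' a = net_flow rv \<omega> c a" if a: "a \<in> arcs G" for a
    proof -
      have "net_flow rv \<omega> c' a = (\<Sum>v\<in>verts G. g v * (if tail G a = v then 1 else 0) - g v * (if head G a = v then 1 else 0))"
        unfolding c'_def net_flow_sum net_flow_cmul using net_cut[OF a]
        by (intro sum.cong) (auto simp: grad_def right_diff_distrib)
      also have "\<dots> = g (tail G a) - g (head G a)"
        using a by (simp add: sum_subtractf if_distrib[of "\<lambda>x. g _ * x"] cong: if_cong)
      finally show ?thesis using g[OF a] by (simp add: grad_def)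
    qed
    then have "c' = c"
      using c closed(1)[OF c'] by (intro net_flow_inject) auto
    then show "c \<in> cut_lattice G rv \<omega>" using c' by simp
  qed
qed

section \<open>The edge group and its map to the sandpile group\<close>

lemma mem_cycles_cuts:
  "c \<in> cycles_cuts G rv \<omega> \<longleftrightarrow> (\<exists>c1\<in>cycle_lattice G rv \<omega>. \<exists>c2\<in>cut_lattice G rv \<omega>. c = c1 + c2)"
  unfolding cycles_cuts_def set_mult_def by auto

lemma cycles_cuts_keys: "c \<in> cycles_cuts G rv \<omega> \<Longrightarrow> keys c \<subseteq> \<omega>"
  unfolding mem_cycles_cuts
  by (metis (no_types, lifting) Un_least cut_lattice_iff cycle_lattice_iff keys_add order_trans)

text \<open>Cycles have zero boundary, and the boundary of a gradient is a Laplacian, hence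
  principal. This makes \<open>edge_group_to_Jac\<close> well defined on cosets.\<close>

lemma cycles_cuts_boundary:
  assumes "c \<in> cycles_cuts G rv \<omega>"
  shows "lin_equiv (boundary G (c + c')) (boundary G c')"
proof -
  obtain c1 c2 g where c: "c = c1 + c2" "\<forall>v\<in>verts G. outflow G (net_flow rv \<omega> c1) v = 0"
    "\<forall>a\<in>arcs G. net_flow rv \<omega> c2 a = grad G g a" "keys c1 \<subseteq> \<omega>" "keys c2 \<subseteq> \<omega>"
    using assms unfolding mem_cycles_cuts Bex_def cycle_lattice_iff cut_lattice_iff by blast
  have "outflow G (net_flow rv \<omega> c2) v = outflow G (grad G g) v" for v
    unfolding outflow_def using c(3) by (intro sum.cong) auto
  then have "lookup (boundary G c) v = laplacian G g v" if "v \<in> verts G" for v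
    using c that unfolding boundary_def
    by (simp add: frag_extend_add lookup_add lookup_boundary[unfolded boundary_def] outflow_grad)
  then show ?thesis
    unfolding lin_equiv_def boundary_def by (intro exI[of _ g]) (simp add: frag_extend_add lookup_add)
qed

lemma cycles_cuts_closed:
  "c \<in> cycles_cuts G rv \<omega> \<Longrightarrow> c' \<in> cycles_cuts G rv \<omega> \<Longrightarrow> c + c' \<in> cycles_cuts G rv \<omega>"
  "c \<in> cycles_cuts G rv \<omega> \<Longrightarrow> - c \<in> cycles_cuts G rv \<omega>"
  "0 \<in> cycles_cuts G rv \<omega>"
proof -
  note cyc = generate_free_Abelian_group_closed[OF cycle_chains, folded cycle_lattice_def]
    and cut = generate_free_Abelian_group_closed[OF cut_chains, folded cut_lattice_def]
  show "0 \<in> cycles_cuts G rv \<omega>"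
    unfolding mem_cycles_cuts using cyc(2) cut(2) by force
  show "- c \<in> cycles_cuts G rv \<omega>" if "c \<in> cycles_cuts G rv \<omega>"
  proof -
    obtain c1 c2 where "c1 \<in> cycle_lattice G rv \<omega>" "c2 \<in> cut_lattice G rv \<omega>" "c = c1 + c2"
      using \<open>c \<in> cycles_cuts G rv \<omega>\<close> unfolding mem_cycles_cuts by blast
    then show ?thesis unfolding mem_cycles_cuts using cyc(4) cut(4)
      by (metis add.commute minus_add_distrib)
  qed
  show "c + c' \<in> cycles_cuts G rv \<omega>" if "c \<in> cycles_cuts G rv \<omega>" "c' \<in> cycles_cuts G rv \<omega>"
  proof -
    obtain c1 c2 c1' c2' where "c1 \<in> cycle_lattice G rv \<omega>" "c2 \<in> cut_lattice G rv \<omega>" "c = c1 + c2"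
      "c1' \<in> cycle_lattice G rv \<omega>" "c2' \<in> cut_lattice G rv \<omega>" "c' = c1' + c2'"
      using \<open>c \<in> cycles_cuts G rv \<omega>\<close> \<open>c' \<in> cycles_cuts G rv \<omega>\<close>
      unfolding mem_cycles_cuts by metis
    then show ?thesis unfolding mem_cycles_cuts using cyc(3)[of c1 c1'] cut(3)[of c2 c2']
      by (intro bexI[of _ "c1 + c1'"] bexI[of _ "c2 + c2'"]) auto
  qed
qed

definition chain_class :: "('b \<Rightarrow>\<^sub>0 int) \<Rightarrow> ('b \<Rightarrow>\<^sub>0 int) set" where
  "chain_class c = cycles_cuts G rv \<omega> #>\<^bsub>free_Abelian_group \<omega>\<^esub> c"

lemma mem_chain_class: "c' \<in> chain_class c \<longleftrightarrow> c' - c \<in> cycles_cuts G rv \<omega>"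
  unfolding chain_class_def r_coset_def by (auto, metis diff_add_cancel)

lemma chain_class_eq:
  assumes "c' \<in> chain_class c"
  shows "chain_class c' = chain_class c"
proof -
  have d: "c' - c \<in> cycles_cuts G rv \<omega>" using assms unfolding mem_chain_class .
  have "e - c' \<in> cycles_cuts G rv \<omega> \<longleftrightarrow> e - c \<in> cycles_cuts G rv \<omega>" for e
    using cycles_cuts_closed(1)[OF _ d, of "e - c'"] cycles_cuts_closed(1)[OF _ cycles_cuts_closed(2)[OF d], of "e - c"]
    by auto
  then show ?thesis by (auto simp: mem_chain_class)
qed

lemma self_mem_chain_class: "c \<in> chain_class c"
  unfolding mem_chain_class using cycles_cuts_closed(3) by simp

lemma carrier_edge_group: "carrier (edge_group G rv \<omega>) = chain_class ` {c. keys c \<subseteq> \<omega>}"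
  unfolding edge_group_def FactGroup_def RCOSETS_def chain_class_def by auto

lemma edge_group_to_Jac_class:
  assumes "keys c \<subseteq> \<omega>"
  shows "edge_group_to_Jac G (chain_class c) = divisor_class G (boundary G c)"
proof -
  have "divisor_class G (boundary G c') = divisor_class G (boundary G c)" if c': "c' \<in> chain_class c" for c'
  proof -
    have d: "c' - c \<in> cycles_cuts G rv \<omega>" using c' unfolding mem_chain_class .
    have "keys c' \<subseteq> \<omega>"
      using cycles_cuts_keys[OF d] assms keys_add[of "c' - c" c] by auto
    then show ?thesis
      using cycles_cuts_boundary[OF d, of c] assms by (simp add: divisor_class_eq_iff boundary_Div0)
  qed
  then have "(\<lambda>c. divisor_class G (boundary G c)) ` chain_class c = {divisor_class G (boundary G c)}"
    using self_mem_chain_class by blast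
  then show ?thesis unfolding edge_group_to_Jac_def by simp
qed

end

end

section \<open>Pairs of dual ribbon graphs\<close>

context connected_multigraph
begin

text \<open>Each vertex other than \<open>q\<close> contributes its rotor and the reversal. No rotor
  is the reversal of a rotor, since the depth would have to drop in both directions. The additive
  form avoids subtraction of natural numbers.\<close>

lemma card_tree_arcs:
  assumes r: "rooted q \<rho> d"
  shows "card (tree_arcs q \<rho>) + 2 = 2 * card (verts G)"
proof -
  have q: "q \<in> verts G" using r unfolding rooted_def by blast
  have inj: "inj_on \<rho> (verts G - {q})"
    using rootedD(2)[OF r] by (metis DiffD1 DiffD2 inj_onI insertI1)
  have "\<rho> v \<noteq> rv (\<rho> u)" if v: "v \<in> verts G - {q}" and u: "u \<in> verts G - {q}" for u v
  proof
    assume e: "\<rho> v = rv (\<rho> u)"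
    have v': "\<rho> v \<in> arcs G" "tail G (\<rho> v) = v" "d (head G (\<rho> v)) < d v"
      and u': "\<rho> u \<in> arcs G" "tail G (\<rho> u) = u" "d (head G (\<rho> u)) < d u"
      using rootedD[OF r, of v] rootedD[OF r, of u] v u by auto
    then have "head G (\<rho> v) = u" "head G (\<rho> u) = v" using e by auto
    then show False using v' u' by simp
  qed
  then have "\<rho> ` (verts G - {q}) \<inter> rv ` \<rho> ` (verts G - {q}) = {}" by blast
  then have "card (tree_arcs q \<rho>) = 2 * (card (verts G) - 1)"
    unfolding tree_arcs_def
    using card_image[OF inj] card_image[OF inj_on_arev, of "\<rho> ` (verts G - {q})"] q
    by (simp add: card_Un_disjoint)
  moreover have "card (verts G) > 0" using q card_gt_0_iff finite_verts by blast
  ultimately show ?thesis by simp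
qed

text \<open>For a spanning tree \<open>T\<close>, the arcs of \<open>T\<close> directed towards
  \<open>q\<close>.\<close>

definition rotor_arc :: "'a \<Rightarrow> 'b set \<Rightarrow> 'b \<Rightarrow> bool" where
  "rotor_arc q T a \<longleftrightarrow> tail G a \<in> verts G - {q} \<and> a = tree_rotor G q T (tail G a)"

context
  fixes T q assumes T: "T \<in> spanning_trees G rv" and q: "q \<in> verts G"
begin

lemma rotor_arc_mem: "rotor_arc q T a \<Longrightarrow> a \<in> T"
  using spanning_tree_rooted[OF T q] unfolding rotor_arc_def tree_arcs_def by (metis UnI1 image_eqI)

lemma rotor_arc_rv:
  assumes "a \<in> T" shows "rotor_arc q T (rv a) \<longleftrightarrow> \<not> rotor_arc q T a"
proof -
  obtain d where d: "rooted q (tree_rotor G q T) d" "T = tree_arcs q (tree_rotor G q T)"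
    using spanning_tree_rooted[OF T q] by blast
  have a: "a \<in> arcs G" using assms spanning_treesD(1)[OF T] by blast
  have "\<not> (rotor_arc q T a \<and> rotor_arc q T (rv a))"
  proof
    assume *: "rotor_arc q T a \<and> rotor_arc q T (rv a)"
    then have "d (head G a) < d (tail G a)" "d (head G (rv a)) < d (tail G (rv a))"
      using rootedD(3)[OF d(1), of "tail G a"] rootedD(3)[OF d(1), of "tail G (rv a)"]
      unfolding rotor_arc_def by auto
    then show False using a by simp
  qed
  moreover from assms have "a \<in> tree_arcs q (tree_rotor G q T)" using d(2) by simp
  then have "rotor_arc q T a \<or> rotor_arc q T (rv a)"
    using d(1)
  proof (cases rule: tree_arcs_cases)
    case up
    then show ?thesis unfolding rotor_arc_def by simp
  next
    case down
    then have "rv a = tree_rotor G q T (tail G (rv a))" using a by (metis arev_arev tail_arev)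
    moreover have "tail G (rv a) \<in> verts G - {q}" using down(1,2) a by simp
    ultimately show ?thesis unfolding rotor_arc_def by blast
  qed
  ultimately show ?thesis by blast
qed

lemma sum_rotor_arcs:
  "(\<Sum>a\<in>arcs G. of_bool (rotor_arc q T a) * F a) = (\<Sum>v\<in>verts G - {q}. F (tree_rotor G q T v) :: int)"
proof -
  obtain d where d: "rooted q (tree_rotor G q T) d" using spanning_tree_rooted[OF T q] by blast
  have "(\<Sum>a\<in>arcs G. of_bool (rotor_arc q T a) * F a) = (\<Sum>a\<in>{a \<in> arcs G. rotor_arc q T a}. F a)"
    by (rule sum.mono_neutral_cong_right) auto
  also have "\<dots> = (\<Sum>v\<in>verts G - {q}. F (tree_rotor G q T v))"
    using rootedD[OF d]
    by (intro sum.reindex_bij_witness[of _ "tree_rotor G q T" "tail G"]) (auto simp: rotor_arc_def)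
  finally show ?thesis .
qed

text \<open>The value is the same for every tree, so this contribution cancels when two trees with
  the same root are compared.\<close>

lemma outflow_rotor_arcs:
  assumes "v \<in> verts G"
  shows "outflow G (\<lambda>a. of_bool (rotor_arc q T a)) v = of_bool (v \<noteq> q)"
proof -
  obtain d where d: "rooted q (tree_rotor G q T) d" using spanning_tree_rooted[OF T q] by blast
  have "outflow G (\<lambda>a. of_bool (rotor_arc q T a)) v
      = (\<Sum>a\<in>arcs G. of_bool (rotor_arc q T a) * of_bool (tail G a = v))"
    unfolding outflow_def by (rule sum.mono_neutral_cong_left) auto
  also have "\<dots> = (\<Sum>u\<in>verts G - {q}. of_bool (u = v))"
    unfolding sum_rotor_arcs using rootedD(2)[OF d] by (intro sum.cong) auto
  also have "\<dots> = of_bool (v \<noteq> q)"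
    using assms by (simp add: of_bool_def)
  finally show ?thesis .
qed

lemma rotor_arcs_monotone:
  assumes mono: "\<And>a. rotor_arc q T a \<Longrightarrow> g (head G a) \<le> (g (tail G a) :: int)" and v: "v \<in> verts G"
  shows "g q \<le> g v"
proof -
  obtain d where d: "rooted q (tree_rotor G q T) d" using spanning_tree_rooted[OF T q] by blast
  show ?thesis
    using v
  proof (induction "d v" arbitrary: v rule: less_induct)
    case less
    show ?case
    proof (cases "v = q")
      case False
      note r = rootedD[OF d less.prems False]
      have "rotor_arc q T (tree_rotor G q T v)" using r less.prems False by (auto simp: rotor_arc_def)
      from mono[OF this] less.hyps[OF r(3)] r show ?thesis by simp
    qed simp
  qed
qed

end

end

text \<open>Planar duality in a form symmetric in the two graphs, so that every result may also be
  used with their roles exchanged. \<open>head_succ\<close> says that the face before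
  \<open>\<sigma> a\<close> is the face after \<open>a\<close>; \<open>euler\<close> is Euler's
  formula doubled, as \<open>arcs G\<close> counts each edge twice.\<close>

locale ribbon_pair = G: ribbon_graph G rv \<sigma> + H: ribbon_graph H rv \<tau>
  for G :: "('a, 'b) pre_digraph" and H :: "('c, 'b) pre_digraph" and rv \<sigma> \<tau> :: "'b \<Rightarrow> 'b" +
  assumes arcs_eq: "arcs H = arcs G"
    and succ_eq: "\<tau> = rv \<circ> \<sigma>"
    and head_succ: "a \<in> arcs G \<Longrightarrow> head H (\<sigma> a) = tail H a"
    and euler: "2 * card (verts G) + 2 * card (verts H) = card (arcs G) + 4"
begin

lemma ribbon_pair_dual: "ribbon_pair H G rv \<tau> \<sigma>"
proof
  show "arcs G = arcs H" by (rule arcs_eq[symmetric])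
  show "\<sigma> = rv \<circ> \<tau>" unfolding succ_eq by (simp add: fun_eq_iff)
  show "head G (\<tau> a) = tail G a" if "a \<in> arcs H" for a
    using that unfolding succ_eq arcs_eq by simp
  show "2 * card (verts H) + 2 * card (verts G) = card (arcs H) + 4"
    using euler unfolding arcs_eq by simp
qed

text \<open>The arcs at \<open>v\<close>, seen in the dual, form a closed tour through the faces
  around \<open>v\<close>, so the potential differences cancel: cuts of \<open>H\<close> are cycles
  of \<open>G\<close>.\<close>

lemma outflow_dual_grad: "outflow G (grad H h) v = 0"
proof -
  let ?O = "out_arcs G v"
  have inj: "inj_on \<sigma> ?O" using permutes_inj_on[OF G.succ_permutes] .
  have "\<sigma> ` ?O = ?O"
    using endo_inj_surj[OF G.finite_out_arcs _ inj] G.succ_out_arcs by blast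
  then have "(\<Sum>a\<in>?O. h (head H a)) = (\<Sum>a\<in>?O. h (head H (\<sigma> a)))"
    using sum.reindex[OF inj, of "\<lambda>a. h (head H a)"] by simp
  also have "\<dots> = (\<Sum>a\<in>?O. h (tail H a))"
    by (intro sum.cong) (auto simp: head_succ)
  finally show ?thesis unfolding outflow_def grad_def by (simp add: sum_subtractf)
qed

lemma skew_eq: "skew H rv = skew G rv"
  unfolding skew_def arcs_eq ..

text \<open>If a set of faces is closed under the arcs of \<open>S\<close>, the dual gradient of its
  indicator function vanishes on \<open>S\<close>. It is then a circulation of \<open>G\<close>
  supported on \<open>T\<close>, hence zero, so the set is everything and \<open>S\<close> is
  connected in \<open>H\<close>. A count of arcs then shows that \<open>S\<close> is a tree.\<close>

lemma dual_tree_spanning: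
  assumes T: "T \<in> spanning_trees G rv"
  shows "dual_tree G T \<in> spanning_trees H rv"
proof -
  define S where "S = arcs G - T"
  note Ts = G.spanning_treesD[OF T]
  obtain q where q: "q \<in> verts G" using G.verts_nonempty by blast
  obtain \<rho> d where r: "G.rooted q \<rho> d" "T = G.tree_arcs q \<rho>"
    using G.spanning_tree_rooted[OF T q] by blast
  have S: "S \<subseteq> arcs H" "rv ` S = S"
    unfolding S_def arcs_eq using Ts(2) G.rv_image_arcs
    by (auto simp: image_set_diff[OF bij_is_inj[OF G.bij_arev]])
  have conn: "connected (H.spanning_subgraph S)"
  proof (rule H.connected_spanning_subgraphI[OF S(1)])
    fix U assume U: "U \<subseteq> verts H" "U \<noteq> {}"
      and closed: "\<And>a. a \<in> S \<Longrightarrow> tail H a \<in> U \<Longrightarrow> head H a \<in> U"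
    define h where "h = (\<lambda>f. if f \<in> U then 1 else 0 :: int)"
    have zero: "grad H h a = 0" if a: "a \<in> arcs G" for a
    proof (rule G.tree_flow_zero[OF r(1) _ _ _ a])
      show "skew G rv (grad H h)" using H.skew_grad skew_eq by metis
      show "outflow G (grad H h) v = 0" for v by (rule outflow_dual_grad)
      fix b assume b: "b \<in> arcs G" "b \<notin> G.tree_arcs q \<rho>"
      then have bS: "b \<in> S" "rv b \<in> S"
        using S(2) unfolding S_def r(2)[symmetric] by (blast, metis DiffI image_eqI)
      have "tail H b \<in> U \<longleftrightarrow> head H b \<in> U"
        using closed[OF bS(1)] closed[OF bS(2)] b(1) by (auto simp: arcs_eq)
      then show "grad H h b = 0" by (simp add: grad_def h_def)
    qed
    show "U = verts H"
    proof (rule H.connected_closed[OF U])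
      fix a assume "a \<in> arcs H" "tail H a \<in> U"
      then show "head H a \<in> U" using zero[of a] by (simp add: arcs_eq grad_def h_def split: if_splits)
    qed
  qed
  obtain q' where q': "q' \<in> verts H" using H.verts_nonempty by blast
  obtain \<rho>' d' where r': "H.rooted q' \<rho>' d'" "H.tree_arcs q' \<rho>' \<subseteq> S"
    using H.connected_imp_rooted[OF S conn q'] by blast
  \<comment> \<open>By Euler's formula, \<open>T\<close> and a spanning tree of \<open>H\<close>
    together have as many arcs as \<open>G\<close>, so \<open>S\<close> has no arcs besides those of
    the spanning tree found inside it.\<close>
  have "card S = card (arcs G) - card T"
    unfolding S_def by (rule card_Diff_subset[OF finite_subset[OF Ts(1)] Ts(1)]) simp
  moreover have "card T \<le> card (arcs G)" by (rule card_mono[OF _ Ts(1)]) simp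
  ultimately have "card S = card (H.tree_arcs q' \<rho>')"
    using G.card_tree_arcs[OF r(1)] H.card_tree_arcs[OF r'(1)] euler unfolding r(2)[symmetric] by linarith
  moreover have "finite S" using S(1) finite_subset[OF _ H.finite_arcs] by blast
  ultimately have "S = H.tree_arcs q' \<rho>'"
    using r'(2) by (metis card_subset_eq)
  then show ?thesis
    using H.tree_arcs_spanning_tree[OF r'(1)] unfolding dual_tree_def S_def by simp
qed

text \<open>The converse of \<open>outflow_dual_grad\<close>, which expresses that the surface is a
  sphere. Choose \<open>h\<close> such that its gradient agrees with \<open>z\<close> on a dual
  tree; the difference is a circulation supported on the complementary tree and vanishes.\<close>

lemma flow_dual_potential:
  assumes z: "skew G rv z" and flow: "\<And>v. v \<in> verts G \<Longrightarrow> outflow G z v = 0"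
  obtains h where "\<And>a. a \<in> arcs G \<Longrightarrow> z a = grad H h a"
proof -
  obtain q where q: "q \<in> verts G" using G.verts_nonempty by blast
  obtain q' where q': "q' \<in> verts H" using H.verts_nonempty by blast
  obtain \<rho> d where r: "G.rooted q \<rho> d" using G.rooted_exists[OF q] .
  define T where "T = G.tree_arcs q \<rho>"
  have "dual_tree G T \<in> spanning_trees H rv"
    unfolding T_def by (rule dual_tree_spanning[OF G.tree_arcs_spanning_tree[OF r]])
  then obtain \<rho>' d' where r': "H.rooted q' \<rho>' d'" "arcs G - T = H.tree_arcs q' \<rho>'"
    using H.spanning_tree_rooted[OF _ q'] unfolding dual_tree_def by blast
  obtain h where h: "\<And>a. a \<in> H.tree_arcs q' \<rho>' \<Longrightarrow> grad H h a = z a"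
    using H.tree_potential[OF r'(1)] z skew_eq by metis
  have "z a - grad H h a = 0" if a: "a \<in> arcs G" for a
  proof (rule G.tree_flow_zero[OF r _ _ _ a])
    show "skew G rv (\<lambda>a. z a - grad H h a)"
      using z H.skew_grad[of h] unfolding skew_eq skew_def by auto
    show "outflow G (\<lambda>a. z a - grad H h a) v = 0" if "v \<in> verts G" for v
      unfolding outflow_diff outflow_dual_grad using flow[OF that] by simp
    show "z b - grad H h b = 0" if "b \<in> arcs G" "b \<notin> G.tree_arcs q \<rho>" for b
      using h[of b] that unfolding r'(2)[symmetric] T_def by simp
  qed
  then show thesis using that by fastforce
qed

text \<open>The orientation of all edges in which \<open>T\<close> points towards \<open>q\<close> and the dual tree towards \<open>q'\<close>.
  It does not change when the roles of \<open>G\<close> and \<open>H\<close> are exchanged.\<close>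

definition tree_orientation :: "'a \<Rightarrow> 'c \<Rightarrow> 'b set \<Rightarrow> 'b \<Rightarrow> bool" where
  "tree_orientation q q' T a \<longleftrightarrow> G.rotor_arc q T a \<or> H.rotor_arc q' (dual_tree G T) a"

text \<open>The flow \<open>w\<close> of the overview, nonzero exactly on the edges whose
  orientation differs between the two trees.\<close>

definition reversal_flow :: "'a \<Rightarrow> 'c \<Rightarrow> 'b set \<Rightarrow> 'b set \<Rightarrow> 'b \<Rightarrow> int" where
  "reversal_flow q q' T T' a =
     of_bool (tree_orientation q q' T' a) - of_bool (tree_orientation q q' T a)"

context
  fixes q q' assumes q: "q \<in> verts G" and q': "q' \<in> verts H"
begin

lemma tree_orientation_split:
  assumes T: "T \<in> spanning_trees G rv"
  shows "(of_bool (tree_orientation q q' T a) :: int)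
    = of_bool (G.rotor_arc q T a) + of_bool (H.rotor_arc q' (dual_tree G T) a)"
  using G.rotor_arc_mem[OF T q, of a] H.rotor_arc_mem[OF dual_tree_spanning[OF T] q', of a]
  unfolding tree_orientation_def dual_tree_def by auto

lemma tree_orientation_rv:
  assumes T: "T \<in> spanning_trees G rv" and a: "a \<in> arcs G"
  shows "tree_orientation q q' T (rv a) \<longleftrightarrow> \<not> tree_orientation q q' T a"
proof -
  note T' = dual_tree_spanning[OF T]
  note memG = G.rotor_arc_mem[OF T q] and memH = H.rotor_arc_mem[OF T' q']
  have rvT: "rv a \<in> T \<longleftrightarrow> a \<in> T" using G.spanning_treesD(2)[OF T] by (metis G.arev_arev image_eqI)
  show ?thesis
  proof (cases "a \<in> T")
    case True
    then have "a \<notin> dual_tree G T" "rv a \<notin> dual_tree G T" using rvT by (auto simp: dual_tree_def)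
    then show ?thesis
      using G.rotor_arc_rv[OF T q True] memH unfolding tree_orientation_def by blast
  next
    case False
    then have "a \<in> dual_tree G T" using a by (auto simp: dual_tree_def)
    then show ?thesis
      using H.rotor_arc_rv[OF T' q'] memG False rvT unfolding tree_orientation_def by blast
  qed
qed

context
  fixes T T' assumes T: "T \<in> spanning_trees G rv" and T': "T' \<in> spanning_trees G rv"
begin

lemma skew_reversal_flow: "skew G rv (reversal_flow q q' T T')"
  unfolding skew_def reversal_flow_def
  using tree_orientation_rv[OF T] tree_orientation_rv[OF T'] by (auto simp: of_bool_def)

text \<open>Rotor arcs of \<open>T\<close> and \<open>T'\<close> have equal outflows in
  \<open>G\<close> and cancel. What remains does not mention \<open>q\<close>, which allows
  \<open>tree_unique\<close> to vary the basepoint.\<close>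

lemma outflow_reversal_flow:
  assumes "v \<in> verts G"
  shows "outflow G (reversal_flow q q' T T') v
    = outflow G (\<lambda>a. of_bool (H.rotor_arc q' (dual_tree G T') a)) v
      - outflow G (\<lambda>a. of_bool (H.rotor_arc q' (dual_tree G T) a)) v"
  unfolding reversal_flow_def tree_orientation_split[OF T] tree_orientation_split[OF T']
    outflow_diff outflow_add G.outflow_rotor_arcs[OF T q assms] G.outflow_rotor_arcs[OF T' q assms]
  by simp

lemma outflow_dual_reversal_flow:
  assumes "f \<in> verts H"
  shows "outflow H (reversal_flow q q' T T') f
    = outflow H (\<lambda>a. of_bool (G.rotor_arc q T' a)) f - outflow H (\<lambda>a. of_bool (G.rotor_arc q T a)) f"
  unfolding reversal_flow_def tree_orientation_split[OF T] tree_orientation_split[OF T']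
    outflow_diff outflow_add H.outflow_rotor_arcs[OF dual_tree_spanning[OF T] q' assms]
    H.outflow_rotor_arcs[OF dual_tree_spanning[OF T'] q' assms]
  by simp

text \<open>The two summands of the flow are orthogonal, so the gradient \<open>x\<close> satisfies
  \<open>\<Sum> z x = \<Sum> x\<^sup>2\<close>; as \<open>\<bar>z\<bar> \<le> 1\<close> and \<open>x\<close> is integral, this forces \<open>x \<in> {0, z}\<close> on every arc, so
  that the potential decreases along both trees, once in either direction.\<close>

lemma grad_part_zero:
  assumes z: "\<And>a. a \<in> arcs G \<Longrightarrow> reversal_flow q q' T T' a = grad G g a + y a"
    and y: "skew G rv y" "\<And>v. v \<in> verts G \<Longrightarrow> outflow G y v = 0"
    and a: "a \<in> arcs G"
  shows "grad G g a = 0"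
proof -
  let ?z = "reversal_flow q q' T T'" and ?x = "grad G g"
  have pointwise: "?z a * ?x a \<le> ?x a * ?x a" for a
  proof -
    have "?z a \<in> {-1, 0, 1}" unfolding reversal_flow_def by auto
    then have "?z a * ?x a \<le> \<bar>?x a\<bar>" by auto
    also have "\<dots> \<le> \<bar>?x a\<bar> * \<bar>?x a\<bar>"
      using mult_left_mono[of 1 "\<bar>?x a\<bar>" "\<bar>?x a\<bar>"] by (cases "?x a = 0") simp_all
    finally show ?thesis by simp
  qed
  have "(\<Sum>a\<in>arcs G. ?x a * y a) = 0"
    unfolding G.grad_pairing[OF y(1)] using y(2) by simp
  then have "(\<Sum>a\<in>arcs G. ?x a * ?x a - ?z a * ?x a) = 0"
    using z by (simp add: algebra_simps sum_subtractf sum.distrib sum_negf)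
  then have "\<forall>a\<in>arcs G. ?x a * ?x a - ?z a * ?x a = 0"
    using pointwise by (subst (asm) sum_nonneg_eq_0_iff) auto
  then have dich: "?x a = 0 \<or> ?x a = ?z a" if "a \<in> arcs G" for a
    using that by (metis eq_iff_diff_eq_0 mult_right_cancel)
  have arcs: "G.rotor_arc q T a \<Longrightarrow> a \<in> arcs G" "G.rotor_arc q T' a \<Longrightarrow> a \<in> arcs G" for a
    using G.rotor_arc_mem[OF T q] G.rotor_arc_mem[OF T' q] G.spanning_treesD(1)[OF T] G.spanning_treesD(1)[OF T'] by blast+
  \<comment> \<open>On an arc oriented by \<open>T\<close>, \<open>?z\<close> is -1 or 0, so by
    \<open>dich\<close> the potential does not drop along it; on an arc oriented by
    \<open>T'\<close> the signs are opposite. Following both trees to \<open>q\<close> gives both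
    bounds on \<open>g\<close>, which is therefore constant on the vertices.\<close>
  have "g (tail G a) \<le> g (head G a)" if "G.rotor_arc q T a" for a
    using dich[OF arcs(1)[OF that]] that
    by (auto simp: reversal_flow_def tree_orientation_def grad_def of_bool_def split: if_splits)
  then have le: "g v \<le> g q" if "v \<in> verts G" for v
    using G.rotor_arcs_monotone[OF T q, of "\<lambda>v. - g v"] that by auto
  have "g (head G a) \<le> g (tail G a)" if "G.rotor_arc q T' a" for a
    using dich[OF arcs(2)[OF that]] that
    by (auto simp: reversal_flow_def tree_orientation_def grad_def of_bool_def split: if_splits)
  then have "g q \<le> g v" if "v \<in> verts G" for v
    using G.rotor_arcs_monotone[OF T' q] that by auto
  then show ?thesis
    using le a unfolding grad_def by (metis G.head_in_verts G.tail_in_verts antisym diff_self)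
qed

end

end

end

lemma (in connected_multigraph) outflow_arc:
  assumes b: "b \<in> arcs G"
  shows "outflow G (\<lambda>a. of_bool (a = b) - of_bool (a = rv b)) v
    = of_bool (tail G b = v) - of_bool (head G b = v)"
  using b by (simp add: outflow_def sum_subtractf of_bool_def finite_out_arcs)

section \<open>The reversal flow determines the tree and describes the action\<close>

context ribbon_pair
begin

lemma dual_dual_tree: "T \<in> spanning_trees G rv \<Longrightarrow> dual_tree H (dual_tree G T) = T"
  using G.spanning_treesD(1)[of T] unfolding dual_tree_def arcs_eq by blast

lemma reversal_flow_dual:
  assumes "T \<in> spanning_trees G rv" "T' \<in> spanning_trees G rv"
  shows "ribbon_pair.reversal_flow H G q' q (dual_tree G T) (dual_tree G T') = reversal_flow q q' T T'"
proof -
  interpret D: ribbon_pair H G rv \<tau> \<sigma> by (rule ribbon_pair_dual)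
  show ?thesis
    unfolding fun_eq_iff D.reversal_flow_def reversal_flow_def D.tree_orientation_def tree_orientation_def
      dual_dual_tree[OF assms(1)] dual_dual_tree[OF assms(2)]
    by (simp add: disj_commute)
qed

text \<open>Moving the basepoint from the tail of an arc of \<open>T\<close> to its head reverses
  the orientation of that arc. For an arc outside \<open>T'\<close>, the orientation given by
  \<open>T'\<close> depends on \<open>q'\<close> alone.\<close>

lemma tree_orientation_subset:
  assumes T: "T \<in> spanning_trees G rv" and T': "T' \<in> spanning_trees G rv" and q': "q' \<in> verts H"
    and eq: "\<And>q a. q \<in> verts G \<Longrightarrow> a \<in> arcs G \<Longrightarrow>
      tree_orientation q q' T a \<longleftrightarrow> tree_orientation q q' T' a"
  shows "T \<subseteq> T'"
proof
  fix a assume a: "a \<in> T"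
  then have arc: "a \<in> arcs G" using G.spanning_treesD(1)[OF T] by blast
  then have q: "tail G a \<in> verts G" "head G a \<in> verts G" by auto
  show "a \<in> T'"
  proof (rule ccontr)
    assume nT': "a \<notin> T'"
    have "a \<notin> dual_tree G T" using a unfolding dual_tree_def by blast
    then have "\<not> tree_orientation (tail G a) q' T a"
      using H.rotor_arc_mem[OF dual_tree_spanning[OF T] q'] unfolding tree_orientation_def G.rotor_arc_def
      by blast
    then have "\<not> H.rotor_arc q' (dual_tree G T') a"
      using eq[OF q(1) arc] unfolding tree_orientation_def by blast
    moreover have "\<not> G.rotor_arc (head G a) T (rv a)"
      using arc unfolding G.rotor_arc_def by simp
    then have "tree_orientation (head G a) q' T a"
      using G.rotor_arc_rv[OF T q(2) a] unfolding tree_orientation_def by blast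
    then have "H.rotor_arc q' (dual_tree G T') a"
      using eq[OF q(2) arc] G.rotor_arc_mem[OF T' q(2)] nT' unfolding tree_orientation_def by blast
    ultimately show False by blast
  qed
qed

text \<open>A reversal flow with principal divergence is the sum of a gradient of \<open>G\<close>
  and a gradient of \<open>H\<close>. \<open>grad_part_zero\<close>, applied in both graphs, removes
  both. The assumption is free of \<open>q\<close>, so the orientations agree for all basepoints,
  and these determine the tree.\<close>

lemma tree_unique:
  assumes T: "T \<in> spanning_trees G rv" and T': "T' \<in> spanning_trees G rv" and q': "q' \<in> verts H"
    and k: "\<And>v. v \<in> verts G \<Longrightarrow>
      outflow G (\<lambda>a. of_bool (H.rotor_arc q' (dual_tree G T') a)) v
        - outflow G (\<lambda>a. of_bool (H.rotor_arc q' (dual_tree G T) a)) v = laplacian G k v"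
  shows "T = T'"
proof -
  interpret D: ribbon_pair H G rv \<tau> \<sigma> by (rule ribbon_pair_dual)
  have eq: "tree_orientation q q' T a \<longleftrightarrow> tree_orientation q q' T' a"
    if q: "q \<in> verts G" and a: "a \<in> arcs G" for q a
  proof -
    \<comment> \<open>The sign is chosen because the outflow of a gradient is minus the
      Laplacian.\<close>
    define g where "g = (\<lambda>v. - k v)"
    define y where "y = (\<lambda>a. reversal_flow q q' T T' a - grad G g a)"
    have y: "skew G rv y"
      using skew_reversal_flow[OF q q' T T'] G.skew_grad[of g] unfolding y_def skew_def by auto
    have flow: "outflow G y v = 0" if "v \<in> verts G" for v
      unfolding y_def outflow_diff outflow_reversal_flow[OF q q' T T' that] outflow_grad k[OF that]
        g_def laplacian_minus by simp
    obtain h where h: "\<And>a. a \<in> arcs G \<Longrightarrow> y a = grad H h a"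
      using flow_dual_potential[OF y flow] by blast
    have split: "reversal_flow q q' T T' a = grad G g a + grad H h a" if "a \<in> arcs G" for a
      using h[OF that] unfolding y_def by simp
    have "grad G g a = 0"
      using grad_part_zero[OF q q' T T', of g "grad H h" a] split H.skew_grad[of h] outflow_dual_grad a
      unfolding skew_eq by blast
    \<comment> \<open>In the exchanged pair, the gradient of \<open>h\<close> plays the part of the
      gradient and that of \<open>g\<close> the part of the circulation.\<close>
    moreover have "grad H h a = 0"
      using D.grad_part_zero[OF q' q dual_tree_spanning[OF T] dual_tree_spanning[OF T'], of h "grad G g" a]
        split G.skew_grad[of g] D.outflow_dual_grad a
      unfolding reversal_flow_dual[OF T T'] D.skew_eq arcs_eq by (simp add: add.commute)
    ultimately have "reversal_flow q q' T T' a = 0" using split[OF a] by simp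
    then show ?thesis unfolding reversal_flow_def by (auto split: if_splits simp: of_bool_def)
  qed
  show ?thesis
    using tree_orientation_subset[OF T T' q'] tree_orientation_subset[OF T' T q'] eq by blast
qed

text \<open>A chip that moves along \<open>b = \<sigma> (\<rho> u)\<close> contributes \<open>b\<close> to a chain of \<open>G\<close> whose boundary is the
  change of the divisor. In the dual graph, \<open>b\<close> leads from the face after \<open>b\<close> to the face after the
  previous rotor \<open>\<rho> u\<close>.\<close>

lemma fire_flow:
  assumes "(fire G \<sigma> q)\<^sup>*\<^sup>* (D, \<rho>) (D', \<rho>')" "\<And>v. v \<in> verts G - {q} \<Longrightarrow> \<rho> v \<in> out_arcs G v"
  shows "\<exists>z. skew G rv z \<and> (\<forall>v. outflow G z v = lookup D v - lookup D' v) \<and>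
    (\<forall>f. outflow H z f = (\<Sum>v\<in>verts G - {q}. of_bool (tail H (\<rho>' v) = f) - of_bool (tail H (\<rho> v) = f))) \<and>
    (\<forall>v\<in>verts G - {q}. \<rho>' v \<in> out_arcs G v)"
  using assms(1)
proof (induction rule: rtranclp_induct2)
  case refl
  then show ?case
    using assms(2) by (intro exI[of _ "\<lambda>_. 0"]) (auto simp: skew_def outflow_def)
next
  case (step D1 \<rho>1 D2 \<rho>2)
  then obtain z where z: "skew G rv z" "\<And>v. outflow G z v = lookup D v - lookup D1 v"
    "\<And>f. outflow H z f = (\<Sum>v\<in>verts G - {q}. of_bool (tail H (\<rho>1 v) = f) - of_bool (tail H (\<rho> v) = f))"
    "\<And>v. v \<in> verts G - {q} \<Longrightarrow> \<rho>1 v \<in> out_arcs G v"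
    by blast
  from step.hyps(2) obtain u where u: "u \<in> verts G - {q}"
    and D2: "D2 = D1 - frag_of u + frag_of (head G (\<sigma> (\<rho>1 u)))" and \<rho>2: "\<rho>2 = \<rho>1(u := \<sigma> (\<rho>1 u))"
    by (auto elim: fireE)
  define b where "b = \<sigma> (\<rho>1 u)"
  have arc: "\<rho>1 u \<in> arcs G" "tail G (\<rho>1 u) = u" using z(4)[OF u] by auto
  have b: "b \<in> arcs G" "tail G b = u" unfolding b_def using arc by auto
  have hb: "head H b = tail H (\<rho>1 u)" unfolding b_def by (rule head_succ[OF arc(1)])
  define z' where "z' = (\<lambda>a. z a + (of_bool (a = b) - of_bool (a = rv b)))"
  have "skew G rv z'"
    unfolding skew_def
  proof
    fix a assume a: "a \<in> arcs G"
    have "rv a = b \<longleftrightarrow> a = rv b" "rv a = rv b \<longleftrightarrow> a = b" by (auto simp: G.arev_eq_iff)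
    then show "z' (rv a) = - z' a" using G.skewD[OF z(1) a] unfolding z'_def by simp
  qed
  moreover have "outflow G z' v = lookup D v - lookup D2 v" for v
    unfolding z'_def outflow_add G.outflow_arc[OF b(1)] z(2) D2 b_def[symmetric] b(2)
    by (simp add: lookup_add lookup_minus of_bool_def)
  moreover have "outflow H z' f
      = (\<Sum>v\<in>verts G - {q}. of_bool (tail H (\<rho>2 v) = f) - of_bool (tail H (\<rho> v) = f))" for f
  proof -
    have "(\<Sum>v\<in>verts G - {q}. of_bool (tail H (\<rho>2 v) = f) - of_bool (tail H (\<rho> v) = f) :: int)
        = (\<Sum>v\<in>verts G - {q}. (of_bool (tail H (\<rho>1 v) = f) - of_bool (tail H (\<rho> v) = f))
            + (if v = u then of_bool (tail H b = f) - of_bool (tail H (\<rho>1 u) = f) else 0))"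
      unfolding \<rho>2 b_def by (intro sum.cong) auto
    also have "\<dots> = outflow H z f + (of_bool (tail H b = f) - of_bool (tail H (\<rho>1 u) = f))"
      using u by (simp add: sum.distrib z(3))
    also have "\<dots> = outflow H z' f"
      using H.outflow_arc[of b f] b(1) unfolding z'_def outflow_add hb arcs_eq by simp
    finally show ?thesis by simp
  qed
  moreover have "\<rho>2 v \<in> out_arcs G v" if "v \<in> verts G - {q}" for v
    using z(4)[OF that] b unfolding \<rho>2 b_def by auto
  ultimately show ?case by blast
qed

text \<open>The flow \<open>z\<close> of the routed chips has divergence \<open>D\<close> in
  \<open>G\<close>. In \<open>H\<close> its outflow counts the final rotors minus the initial ones,
  exactly like that of the reversal flow. The difference is a circulation of \<open>H\<close>, hence
  a gradient of \<open>G\<close>, which changes the divergence by a Laplacian.\<close>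

lemma routes_to_reversal_flow:
  assumes T: "T \<in> spanning_trees G rv" and T': "T' \<in> spanning_trees G rv"
    and q: "q \<in> verts G" and q': "q' \<in> verts H"
    and D: "D \<in> carrier (Div0 G)" and route: "routes_to G \<sigma> q D T T'"
  obtains k where "\<And>v. v \<in> verts G \<Longrightarrow>
    lookup D v = outflow G (reversal_flow q q' T T') v + laplacian G k v"
proof -
  interpret D: ribbon_pair H G rv \<tau> \<sigma> by (rule ribbon_pair_dual)
  let ?w = "reversal_flow q q' T T'"
  obtain d where r: "G.rooted q (tree_rotor G q T) d"
    using G.spanning_tree_rooted[OF T q] by blast
  obtain D' \<rho>' where f: "(fire G \<sigma> q)\<^sup>*\<^sup>* (D, tree_rotor G q T) (D', \<rho>')"
    and fin: "\<And>v. v \<in> verts G - {q} \<Longrightarrow> lookup D' v = 0 \<and> \<rho>' v = tree_rotor G q T' v"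
    using route unfolding routes_to_def by blast
  obtain z where z: "skew G rv z" "\<And>v. outflow G z v = lookup D v - lookup D' v"
    "\<And>f. outflow H z f = (\<Sum>v\<in>verts G - {q}. of_bool (tail H (\<rho>' v) = f) - of_bool (tail H (tree_rotor G q T v) = f))"
    using fire_flow[OF f] r unfolding G.rooted_def by blast
  \<comment> \<open>Firing preserves the degree, which is 0, and there are no chips off
    \<open>q\<close>; so the chips at \<open>q\<close> also cancel.\<close>
  have "(\<Sum>v\<in>verts G. lookup D' v) = (\<Sum>v\<in>verts G. lookup D v)"
    using G.sum_outflow[OF z(1)] by (simp add: z(2) sum_subtractf)
  then have "(\<Sum>v\<in>verts G. lookup D' v) = 0" using D unfolding G.Div0_iff by simp
  moreover have "(\<Sum>v\<in>verts G. lookup D' v) = lookup D' q"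
    using q fin by (subst sum.remove[of _ q]) auto
  ultimately have D'0: "lookup D' v = 0" if "v \<in> verts G" for v
    using fin that by (cases "v = q") auto
  have count: "(\<Sum>v\<in>verts G - {q}. of_bool (tail H (tree_rotor G q S v) = f) :: int)
      = outflow H (\<lambda>a. of_bool (G.rotor_arc q S a)) f" if S: "S \<in> spanning_trees G rv" for S f
  proof -
    have "outflow H (\<lambda>a. of_bool (G.rotor_arc q S a)) f
        = (\<Sum>a\<in>arcs G. of_bool (G.rotor_arc q S a) * of_bool (tail H a = f))"
      unfolding outflow_def arcs_eq[symmetric] by (rule sum.mono_neutral_cong_left) auto
    then show ?thesis unfolding G.sum_rotor_arcs[OF S q] by simp
  qed
  define y where "y = (\<lambda>a. z a - ?w a)"
  have "skew H rv y"
    using z(1) skew_reversal_flow[OF q q' T T'] unfolding y_def skew_eq skew_def by auto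
  moreover have "outflow H y f = 0" if f: "f \<in> verts H" for f
  proof -
    have "outflow H z f = (\<Sum>v\<in>verts G - {q}. of_bool (tail H (tree_rotor G q T' v) = f)
        - of_bool (tail H (tree_rotor G q T v) = f))"
      unfolding z(3) using fin by (intro sum.cong) auto
    then show ?thesis
      unfolding y_def outflow_diff outflow_dual_reversal_flow[OF q q' T T' f] sum_subtractf
        count[OF T] count[OF T'] by simp
  qed
  ultimately obtain g where g: "\<And>a. a \<in> arcs H \<Longrightarrow> y a = grad G g a"
    using D.flow_dual_potential by blast
  have "lookup D v = outflow G ?w v + laplacian G (\<lambda>v. - g v) v" if v: "v \<in> verts G" for v
  proof -
    have "outflow G y v = outflow G (grad G g) v"
      unfolding outflow_def using g by (intro sum.cong) (auto simp: arcs_eq)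
    then show ?thesis
      using z(2)[of v] D'0[OF v] unfolding y_def outflow_diff outflow_grad laplacian_minus by simp
  qed
  then show thesis by (rule that)
qed

text \<open>Two representatives of \<open>x\<close> differ by a Laplacian. In the difference of the
  two divergences the part due to \<open>T\<close> cancels, which leaves the assumption of
  \<open>tree_unique\<close>. This justifies the definite description in
  \<open>rotor_action\<close>.\<close>

lemma rotor_action_class_unique:
  assumes x: "x \<in> carrier (Jac G)" and T: "T \<in> spanning_trees G rv"
    and q: "q \<in> verts G" and q': "q' \<in> verts H"
    and T1: "T1 \<in> spanning_trees G rv" "D1 \<in> x" "\<And>v. v \<in> verts G \<Longrightarrow>
      lookup D1 v = outflow G (reversal_flow q q' T T1) v + laplacian G k1 v"
    and T2: "T2 \<in> spanning_trees G rv" "D2 \<in> x" "\<And>v. v \<in> verts G \<Longrightarrow>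
      lookup D2 v = outflow G (reversal_flow q q' T T2) v + laplacian G k2 v"
  shows "T1 = T2"
proof -
  have "G.lin_equiv D2 D1"
    using G.Jac_class[OF x T1(2)] G.Jac_class[OF x T2(2)] G.divisor_class_eq_iff by metis
  then obtain k where k: "\<And>v. v \<in> verts G \<Longrightarrow> lookup D2 v - lookup D1 v = laplacian G k v"
    unfolding G.lin_equiv_def by blast
  have "outflow G (\<lambda>a. of_bool (H.rotor_arc q' (dual_tree G T2) a)) v
        - outflow G (\<lambda>a. of_bool (H.rotor_arc q' (dual_tree G T1) a)) v
      = laplacian G (\<lambda>v. k v - (k2 v - k1 v)) v" if v: "v \<in> verts G" for v
    using T1(3)[OF v] T2(3)[OF v] k[OF v] outflow_reversal_flow[OF q q' T T1(1) v]
      outflow_reversal_flow[OF q q' T T2(1) v]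
    unfolding laplacian_diff by simp
  then show ?thesis using tree_unique[OF T1(1) T2(1) q'] by blast
qed

lemma rotor_action_exists:
  assumes x: "x \<in> carrier (Jac G)" and T: "T \<in> spanning_trees G rv"
    and q: "q \<in> verts G" and q': "q' \<in> verts H"
  obtains T' D k where "T' \<in> spanning_trees G rv" "D \<in> x"
    "\<forall>v\<in>verts G - {q}. 0 \<le> lookup D v" "routes_to G \<sigma> q D T T'"
    "\<And>v. v \<in> verts G \<Longrightarrow> lookup D v = outflow G (reversal_flow q q' T T') v + laplacian G k v"
proof -
  obtain D where D: "D \<in> x" "\<And>v. v \<in> verts G \<Longrightarrow> v \<noteq> q \<Longrightarrow> 0 \<le> lookup D v"
    using G.Jac_effective_off[OF x q] by blast
  obtain T' where T': "T' \<in> spanning_trees G rv" "routes_to G \<sigma> q D T T'"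
    using G.routes_to_exists[OF T q D(2)] by blast
  obtain k where "\<And>v. v \<in> verts G \<Longrightarrow>
      lookup D v = outflow G (reversal_flow q q' T T') v + laplacian G k v"
    using routes_to_reversal_flow[OF T T'(1) q q' G.Jac_class(1)[OF x D(1)] T'(2)] by blast
  then show thesis using that[OF T'(1) D(1) _ T'(2)] D(2) by blast
qed

text \<open>A criterion that no longer mentions routing: the divergence of the reversal flow has to
  represent \<open>x\<close> up to a Laplacian. Being symmetric in the graph and its dual, it can be
  used on both sides of the duality.\<close>

lemma rotor_action_eqI:
  assumes x: "x \<in> carrier (Jac G)" and T: "T \<in> spanning_trees G rv"
    and q: "q \<in> verts G" and q': "q' \<in> verts H"
    and T': "T' \<in> spanning_trees G rv" and D: "D \<in> x" "\<And>v. v \<in> verts G \<Longrightarrow>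
      lookup D v = outflow G (reversal_flow q q' T T') v + laplacian G k v"
  shows "rotor_action G rv \<sigma> q x T = T'"
  unfolding rotor_action_def
proof (rule the_equality)
  obtain T0 D0 k0 where T0: "T0 \<in> spanning_trees G rv" "D0 \<in> x"
    "\<forall>v\<in>verts G - {q}. 0 \<le> lookup D0 v" "routes_to G \<sigma> q D0 T T0"
    and k0: "\<And>v. v \<in> verts G \<Longrightarrow> lookup D0 v = outflow G (reversal_flow q q' T T0) v + laplacian G k0 v"
    using rotor_action_exists[OF x T q q'] by blast
  have "T0 = T'"
    by (rule rotor_action_class_unique[OF x T q q' T0(1,2) k0 T' D])
  then show "T' \<in> spanning_trees G rv \<and>
      (\<exists>D\<in>x. (\<forall>v\<in>verts G - {q}. 0 \<le> lookup D v) \<and> routes_to G \<sigma> q D T T')"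
    using T0 by blast
next
  fix S assume S: "S \<in> spanning_trees G rv \<and>
      (\<exists>D\<in>x. (\<forall>v\<in>verts G - {q}. 0 \<le> lookup D v) \<and> routes_to G \<sigma> q D T S)"
  then obtain E where E: "E \<in> x" "routes_to G \<sigma> q E T S" by blast
  obtain k' where k': "\<And>v. v \<in> verts G \<Longrightarrow>
      lookup E v = outflow G (reversal_flow q q' T S) v + laplacian G k' v"
    using routes_to_reversal_flow[OF T _ q q' G.Jac_class(1)[OF x E(1)] E(2)] S by blast
  show "S = T'"
    by (rule rotor_action_class_unique[OF x T q q' conjunct1[OF S] E(1) k' T' D])
qed

section \<open>Cycles, cuts and boundaries under duality\<close>

context
  fixes \<omega> assumes orient: "orientation G rv \<omega>"
begin

lemma orientation_dual: "orientation H rv \<omega>"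
  using orient unfolding orientation_def arcs_eq .

lemma cycle_lattice_dual: "cycle_lattice G rv \<omega> = cut_lattice H rv \<omega>"
proof -
  have "(\<forall>v\<in>verts G. outflow G (net_flow rv \<omega> c) v = 0) \<longleftrightarrow>
      (\<exists>h. \<forall>a\<in>arcs H. net_flow rv \<omega> c a = grad H h a)" for c
  proof
    assume "\<forall>v\<in>verts G. outflow G (net_flow rv \<omega> c) v = 0"
    then show "\<exists>h. \<forall>a\<in>arcs H. net_flow rv \<omega> c a = grad H h a"
      using flow_dual_potential[OF G.skew_net_flow[OF orient]] unfolding arcs_eq by metis
  next
    assume "\<exists>h. \<forall>a\<in>arcs H. net_flow rv \<omega> c a = grad H h a"
    then obtain h where h: "\<And>a. a \<in> arcs G \<Longrightarrow> net_flow rv \<omega> c a = grad H h a"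
      unfolding arcs_eq by blast
    have "outflow G (net_flow rv \<omega> c) v = outflow G (grad H h) v" for v
      unfolding outflow_def using h by (intro sum.cong) auto
    then show "\<forall>v\<in>verts G. outflow G (net_flow rv \<omega> c) v = 0" by (simp add: outflow_dual_grad)
  qed
  then show ?thesis
    by (auto simp: G.cycle_lattice_iff[OF orient] H.cut_lattice_iff[OF orientation_dual])
qed

end

text \<open>Duality interchanges the cycle and the cut lattice, so the sum is the same subgroup and
  the identity on chains descends to the edge groups.\<close>

lemma cycles_cuts_dual:
  assumes orient: "orientation G rv \<omega>"
  shows "cycles_cuts H rv \<omega> = cycles_cuts G rv \<omega>"
proof -
  interpret D: ribbon_pair H G rv \<tau> \<sigma> by (rule ribbon_pair_dual)
  have "cycle_lattice H rv \<omega> = cut_lattice G rv \<omega>"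
    by (rule D.cycle_lattice_dual[OF orientation_dual[OF orient]])
  moreover have "(\<exists>c1\<in>A. \<exists>c2\<in>B. c = c1 + c2) \<longleftrightarrow> (\<exists>c2\<in>B. \<exists>c1\<in>A. c = c2 + c1)"
    for A B and c :: "'b \<Rightarrow>\<^sub>0 int"
    by (metis add.commute)
  ultimately show ?thesis
    unfolding set_eq_iff G.mem_cycles_cuts[OF orient] H.mem_cycles_cuts[OF orientation_dual[OF orient]]
      cycle_lattice_dual[OF orient] by blast
qed

text \<open>The two flows differ by a gradient of \<open>G\<close> plus a circulation of
  \<open>G\<close>. In \<open>H\<close> the former is a circulation and the latter a gradient, so
  the dual boundaries differ by a Laplacian.\<close>

lemma dual_boundary_class:
  assumes orient: "orientation G rv \<omega>" and c: "keys c \<subseteq> \<omega>" "keys c' \<subseteq> \<omega>"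
    and equiv: "G.lin_equiv (boundary G c) (boundary G c')"
  shows "H.lin_equiv (boundary H c) (boundary H c')"
proof -
  interpret D: ribbon_pair H G rv \<tau> \<sigma> by (rule ribbon_pair_dual)
  note orient' = orientation_dual[OF orient]
  obtain k where k: "\<And>v. v \<in> verts G \<Longrightarrow> lookup (boundary G c) v - lookup (boundary G c') v = laplacian G k v"
    using equiv unfolding G.lin_equiv_def by blast
  define y where "y = (\<lambda>a. net_flow rv \<omega> c a - net_flow rv \<omega> c' a - grad G k a)"
  have "skew G rv y"
    using G.skew_net_flow[OF orient, of c] G.skew_net_flow[OF orient, of c'] G.skew_grad[of k]
    unfolding y_def skew_def by auto
  moreover have "outflow G y v = 0" if "v \<in> verts G" for v
    using k[OF that] unfolding y_def outflow_diff outflow_grad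
    by (simp add: G.lookup_boundary[OF orient c(1)] G.lookup_boundary[OF orient c(2)])
  ultimately obtain h where h: "\<And>a. a \<in> arcs G \<Longrightarrow> y a = grad H h a"
    using flow_dual_potential by blast
  have "outflow H y f = outflow H (grad H h) f" for f
    unfolding outflow_def using h by (intro sum.cong) (auto simp: arcs_eq)
  then have "outflow H (net_flow rv \<omega> c) f - outflow H (net_flow rv \<omega> c') f = - laplacian H h f" for f
    unfolding y_def outflow_diff D.outflow_dual_grad outflow_grad by simp
  then show ?thesis
    unfolding H.lin_equiv_def H.lookup_boundary[OF orient' c(1)] H.lookup_boundary[OF orient' c(2)]
    by (intro exI[of _ h]) (simp add: algebra_simps)
qed

end

section \<open>The dual of a planar ribbon graph\<close>

context planar_ribbon_graph
begin

lemma card_arcs: "card (arcs G) = 2 * card (edges G rv)"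
proof -
  have "{b \<in> arcs G. {b, rv b} = {a, rv a}} = {a, rv a}" if "a \<in> arcs G" for a
    using that by (auto simp: doubleton_eq_iff)
  then have two: "(\<Sum>b\<in>{b \<in> arcs G. {b, rv b} = e}. 1) = (2 :: nat)" if "e \<in> edges G rv" for e
    using that arev_neq unfolding edges_def by fastforce
  have "card (arcs G) = (\<Sum>e\<in>edges G rv. \<Sum>b\<in>{b \<in> arcs G. {b, rv b} = e}. 1)"
    unfolding edges_def by (subst sum.group) auto
  also have "\<dots> = (\<Sum>e\<in>edges G rv. 2)"
    using two by (intro sum.cong) auto
  finally show ?thesis by simp
qed

lemma face_permutes: "\<sigma> \<circ> rv permutes arcs G"
  by (rule permutes_compose[OF arev_permutes_arcs succ_permutes])

lemma face_permutation: "permutation (\<sigma> \<circ> rv)"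
  using face_permutes permutation_permutes finite_arcs by blast

lemma face_before_succ_rv: "face_before rv \<sigma> (\<sigma> (rv a)) = face_before rv \<sigma> a"
  using permutation_orbit_step[OF face_permutation, of a] unfolding face_before_def by simp

lemma dual_simps [simp]:
  "verts (dual G rv \<sigma>) = faces G rv \<sigma>" "arcs (dual G rv \<sigma>) = arcs G"
  "tail (dual G rv \<sigma>) = face_after rv \<sigma>" "head (dual G rv \<sigma>) = face_before rv \<sigma>"
  by (simp_all add: dual_def)

text \<open>Let \<open>S\<close> consist of the arcs whose face lies in \<open>U\<close>. Crossing
  edges keeps \<open>S\<close> closed under \<open>\<sigma>\<close>, so with one arc it contains all
  arcs at the same tail; walking along faces then spreads \<open>S\<close> to adjacent vertices and
  so, \<open>G\<close> being connected, to all arcs.\<close>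

lemma dual_connected:
  assumes "wf_digraph (dual G rv \<sigma>)"
  shows "connected (dual G rv \<sigma>)"
proof (rule wf_digraph.connectedI_closed[OF assms])
  show "verts (dual G rv \<sigma>) \<noteq> {}" by (simp add: faces_def)
  fix U assume U: "U \<subseteq> verts (dual G rv \<sigma>)" "U \<noteq> {}"
    and closed: "\<And>a. a \<in> arcs (dual G rv \<sigma>) \<Longrightarrow> tail (dual G rv \<sigma>) a \<in> U \<Longrightarrow> head (dual G rv \<sigma>) a \<in> U"
  show "U = verts (dual G rv \<sigma>)"
  proof (cases "arcs G = {}")
    case True
    then show ?thesis using U by (auto simp: faces_def)
  next
    case False
    define S where "S = {a \<in> arcs G. face_before rv \<sigma> a \<in> U}"
    have succ: "\<sigma> a \<in> S" if "a \<in> S" for a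
    proof -
      have "face_before rv \<sigma> (rv a) \<in> U"
        using closed[of "rv a"] that unfolding S_def by (simp add: face_after_def face_before_succ_rv)
      then show ?thesis using that face_before_succ_rv[of "rv a"] unfolding S_def by simp
    qed
    have turn: "b \<in> S" if "a \<in> S" "b \<in> arcs G" "tail G b = tail G a" for a b
    proof -
      have "a \<in> arcs G" using that unfolding S_def by simp
      then have "b \<in> orbit \<sigma> a"
        using succ_cyclic[of "tail G a"] that(2,3) unfolding cyclic_on_alldef
        by (metis empty_iff in_out_arcs_conv tail_in_verts)
      then show ?thesis by induction (use succ that(1) in auto)
    qed
    define W where "W = tail G ` S"
    have "W = verts G"
    proof (rule connected_closed)
      show "W \<subseteq> verts G" unfolding W_def S_def by auto
      show "W \<noteq> {}" using U False unfolding W_def S_def by (auto simp: faces_def)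
      fix a assume a: "a \<in> arcs G" "tail G a \<in> W"
      then have "a \<in> S" using turn unfolding W_def by auto
      then have "\<sigma> (rv a) \<in> S" using a(1) unfolding S_def by (simp add: face_before_succ_rv)
      then have "tail G (\<sigma> (rv a)) \<in> W" unfolding W_def by blast
      then show "head G a \<in> W" using a(1) by simp
    qed
    then have "a \<in> S" if "a \<in> arcs G" for a
      using that turn unfolding W_def by (metis imageE tail_in_verts)
    then show ?thesis using U False unfolding S_def by (auto simp: faces_def)
  qed
qed

text \<open>\<open>\<sigma>\<close> conjugates \<open>rv \<circ> \<sigma>\<close> to
  \<open>\<sigma> \<circ> rv\<close>, so it carries orbits of the dual successor to faces; the face
  after \<open>a\<close> is the orbit of \<open>\<sigma> a\<close>.\<close>

lemma dual_out_arcs: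
  assumes a: "a \<in> arcs G"
  shows "out_arcs (dual G rv \<sigma>) (face_after rv \<sigma> a) = orbit (dual_succ rv \<sigma>) a"
proof (intro subset_antisym subsetI)
  note perm = permutes_compose[OF succ_permutes arev_permutes_arcs]
  fix b assume b: "b \<in> orbit (dual_succ rv \<sigma>) a"
  then have "b \<in> arcs G"
    using permutes_orbit_subset[OF perm a] unfolding dual_succ_def by blast
  moreover from b have "face_after rv \<sigma> b = face_after rv \<sigma> a"
    by induction (simp_all add: dual_succ_def face_after_def face_before_succ_rv)
  ultimately show "b \<in> out_arcs (dual G rv \<sigma>) (face_after rv \<sigma> a)" by simp
next
  fix b assume "b \<in> out_arcs (dual G rv \<sigma>) (face_after rv \<sigma> a)"
  then have "\<sigma> b \<in> orbit (\<sigma> \<circ> rv) (\<sigma> a)"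
    using permutation_self_in_orbit[OF face_permutation, of "\<sigma> b"]
    by (simp add: face_after_def face_before_def)
  then have "\<exists>c\<in>orbit (dual_succ rv \<sigma>) a. \<sigma> b = \<sigma> c"
  proof induction
    case base
    show ?case by (rule bexI[OF _ orbit.base]) (simp add: dual_succ_def)
  next
    case (step y)
    then obtain c where "c \<in> orbit (dual_succ rv \<sigma>) a" "y = \<sigma> c" by blast
    then have "dual_succ rv \<sigma> c \<in> orbit (dual_succ rv \<sigma>) a" "(\<sigma> \<circ> rv) y = \<sigma> (dual_succ rv \<sigma> c)"
      by (auto intro: orbit.step) (simp add: dual_succ_def)
    then show ?case by blast
  qed
  then show "b \<in> orbit (dual_succ rv \<sigma>) a"
    using permutes_inj[OF succ_permutes] by (auto dest: injD)
qed

text \<open>The sphere condition \<open>euler_sphere\<close> enters here, through the count of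
  vertices, faces and arcs.\<close>

lemma ribbon_pair_planar: "ribbon_pair G (dual G rv \<sigma>) rv \<sigma> (dual_succ rv \<sigma>)"
proof -
  have wf: "wf_digraph (dual G rv \<sigma>)"
    by unfold_locales (auto simp: faces_def face_after_def)
  interpret D: wf_digraph "dual G rv \<sigma>" by (rule wf)
  have perm: "dual_succ rv \<sigma> permutes arcs G"
    unfolding dual_succ_def by (rule permutes_compose[OF succ_permutes arev_permutes_arcs])
  interpret D: ribbon_graph "dual G rv \<sigma>" rv "dual_succ rv \<sigma>"
  proof
    show "finite (verts (dual G rv \<sigma>))" by (simp add: faces_def)
    show "finite (arcs (dual G rv \<sigma>))" by simp
    show "a \<in> arcs (dual G rv \<sigma>) \<longleftrightarrow> rv a \<noteq> a" for a by (simp add: arev_dom)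
    show "rv (rv a) = a" for a by simp
    show "tail (dual G rv \<sigma>) (rv a) = head (dual G rv \<sigma>) a" for a
      by (simp add: face_after_def face_before_succ_rv)
    show "connected (dual G rv \<sigma>)" by (rule dual_connected[OF wf])
    show "dual_succ rv \<sigma> permutes arcs (dual G rv \<sigma>)" using perm by simp
    fix f assume "out_arcs (dual G rv \<sigma>) f \<noteq> {}"
    then obtain a where "a \<in> out_arcs (dual G rv \<sigma>) f" by blast
    then have "a \<in> arcs G" "face_after rv \<sigma> a = f" by simp_all
    then show "cyclic_on (dual_succ rv \<sigma>) (out_arcs (dual G rv \<sigma>) f)"
      using dual_out_arcs cyclic_on_orbit[OF perm] by auto
  qed
  show ?thesis
  proof
    show "arcs (dual G rv \<sigma>) = arcs G" by simp
    show "dual_succ rv \<sigma> = rv \<circ> \<sigma>" by (rule dual_succ_def)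
    show "head (dual G rv \<sigma>) (\<sigma> a) = tail (dual G rv \<sigma>) a" for a by (simp add: face_after_def)
    show "2 * card (verts G) + 2 * card (verts (dual G rv \<sigma>)) = card (arcs G) + 4"
      using euler_sphere unfolding card_arcs by simp
  qed
qed

text \<open>The inverse in \<open>duality_iso\<close> may select a class represented by another
  chain \<open>c'\<close> whose boundary is equivalent to that of \<open>c\<close>; by
  \<open>dual_boundary_class\<close> this choice does not affect the result.\<close>

lemma duality_iso_class:
  assumes orient: "orientation G rv \<omega>" and c: "keys c \<subseteq> \<omega>"
  shows "duality_iso G rv \<sigma> \<omega> (divisor_class G (boundary G c))
    = divisor_class (dual G rv \<sigma>) (boundary (dual G rv \<sigma>) c)"
proof -
  let ?H = "dual G rv \<sigma>"
  interpret P: ribbon_pair G ?H rv \<sigma> "dual_succ rv \<sigma>" by (rule ribbon_pair_planar)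
  note orient' = P.orientation_dual[OF orient]
  define X where "X = inv_into (carrier (edge_group G rv \<omega>)) (edge_group_to_Jac G) (divisor_class G (boundary G c))"
  have mem: "divisor_class G (boundary G c) \<in> edge_group_to_Jac G ` carrier (edge_group G rv \<omega>)"
    using c edge_group_to_Jac_class[OF orient c] unfolding carrier_edge_group[OF orient]
    by (metis (mono_tags, lifting) image_eqI mem_Collect_eq)
  then have "X \<in> carrier (edge_group G rv \<omega>)"
    unfolding X_def by (rule inv_into_into)
  then obtain c' where c': "keys c' \<subseteq> \<omega>" "X = chain_class \<omega> c'"
    unfolding carrier_edge_group[OF orient] by blast
  have "edge_group_to_Jac G X = divisor_class G (boundary G c)"
    unfolding X_def by (rule f_inv_into_f[OF mem])
  then have "lin_equiv (boundary G c') (boundary G c)"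
    unfolding c'(2) edge_group_to_Jac_class[OF orient c'(1)]
    by (simp add: divisor_class_eq_iff boundary_Div0[OF orient] c c'(1))
  then have equiv: "P.H.lin_equiv (boundary ?H c') (boundary ?H c)"
    by (rule P.dual_boundary_class[OF orient c'(1) c])
  have chain: "P.H.chain_class \<omega> e = chain_class \<omega> e" for e
    unfolding P.H.chain_class_def[OF orient'] chain_class_def[OF orient] P.cycles_cuts_dual[OF orient] ..
  have "(\<lambda>e. cycles_cuts ?H rv \<omega> #>\<^bsub>free_Abelian_group \<omega>\<^esub> e) ` X = {P.H.chain_class \<omega> c'}"
    unfolding P.H.chain_class_def[OF orient', symmetric] chain c'(2)
    using chain_class_eq[OF orient, of _ c'] self_mem_chain_class[OF orient, of c'] by blast
  then have "edge_group_to_dual G rv \<sigma> \<omega> X = P.H.chain_class \<omega> c'"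
    unfolding edge_group_to_dual_def by simp
  then have "duality_iso G rv \<sigma> \<omega> (divisor_class G (boundary G c)) = divisor_class ?H (boundary ?H c')"
    unfolding duality_iso_def o_def X_def[symmetric]
    using P.H.edge_group_to_Jac_class[OF orient' c'(1)] by simp
  also have "\<dots> = divisor_class ?H (boundary ?H c)"
    using equiv by (simp add: P.H.divisor_class_eq_iff P.H.boundary_Div0[OF orient'] c c'(1))
  finally show ?thesis .
qed

end

section \<open>Compatibility of rotor-routing with planar duality\<close>

theorem theorem3p1:
  fixes G :: "('a, 'b) pre_digraph" and rv \<sigma> :: "'b \<Rightarrow> 'b"
  assumes "planar_ribbon_graph G rv \<sigma>"
    and "loopfree_digraph G" and "loopfree_digraph (dual G rv \<sigma>)"
    and "orientation G rv \<omega>"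
    and "q \<in> verts G" and "q' \<in> verts (dual G rv \<sigma>)"
    and "x \<in> carrier (Jac G)" and "T \<in> spanning_trees G rv"
  shows "dual_tree G (rotor_action G rv \<sigma> q x T) =
    rotor_action (dual G rv \<sigma>) rv (dual_succ rv \<sigma>) q' (duality_iso G rv \<sigma> \<omega> x) (dual_tree G T)"
proof -
  let ?H = "dual G rv \<sigma>"
  interpret planar_ribbon_graph G rv \<sigma> by (rule assms(1))
  interpret P: ribbon_pair G ?H rv \<sigma> "dual_succ rv \<sigma>" by (rule ribbon_pair_planar)
  interpret D: ribbon_pair ?H G rv "dual_succ rv \<sigma>" \<sigma> by (rule P.ribbon_pair_dual)
  note orient = assms(4) and q = assms(5) and q' = assms(6) and x = assms(7) and T = assms(8)
  note orient' = P.orientation_dual[OF orient]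
  obtain T' D k where T': "T' \<in> spanning_trees G rv" and D: "D \<in> x"
    and k: "\<And>v. v \<in> verts G \<Longrightarrow> lookup D v = outflow G (P.reversal_flow q q' T T') v + laplacian G k v"
    using P.rotor_action_exists[OF x T q q'] by metis
  have "rotor_action G rv \<sigma> q x T = T'"
    by (rule P.rotor_action_eqI[OF x T q q' T' D k])
  define w where "w = P.reversal_flow q q' T T'"
  \<comment> \<open>The negative flow is taken because \<open>boundary\<close> counts heads minus
    tails. The boundary of \<open>c\<close> is then the divergence of \<open>w\<close>, in
    \<open>G\<close> and in the dual alike.\<close>
  have "skew G rv (\<lambda>a. - w a)"
    using P.skew_reversal_flow[OF q q' T T'] unfolding w_def skew_def by simp
  then obtain c where c: "keys c \<subseteq> \<omega>" "\<And>a. a \<in> arcs G \<Longrightarrow> net_flow rv \<omega> c a = - w a"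
    using net_flow_surj[OF orient] by metis
  have bG: "lookup (boundary G c) v = outflow G w v" for v
    unfolding lookup_boundary[OF orient c(1)] outflow_def sum_negf[symmetric]
    using c(2) by (intro sum.cong) auto
  have bH: "lookup (boundary ?H c) f = outflow ?H w f" for f
    unfolding P.H.lookup_boundary[OF orient' c(1)] outflow_def sum_negf[symmetric]
    using c(2) by (intro sum.cong) auto
  have "lin_equiv D (boundary G c)"
    unfolding lin_equiv_def bG using k unfolding w_def by (intro exI[of _ k]) simp
  then have "x = divisor_class G (boundary G c)"
    using Jac_class[OF x D] boundary_Div0[OF orient c(1)] by (simp add: divisor_class_eq_iff)
  then have \<phi>x: "duality_iso G rv \<sigma> \<omega> x = divisor_class ?H (boundary ?H c)"
    using duality_iso_class[OF orient c(1)] by simp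
  have Jac: "duality_iso G rv \<sigma> \<omega> x \<in> carrier (Jac ?H)"
    unfolding \<phi>x P.H.carrier_Jac using P.H.boundary_Div0[OF orient' c(1)] by blast
  \<comment> \<open>The flow \<open>w\<close> is also the reversal flow of the dual trees, so the
    boundary of \<open>c\<close> in the dual is exactly the divergence required, with zero
    potential.\<close>
  have "rotor_action ?H rv (dual_succ rv \<sigma>) q' (duality_iso G rv \<sigma> \<omega> x) (dual_tree G T) = dual_tree G T'"
  proof (rule D.rotor_action_eqI[OF Jac P.dual_tree_spanning[OF T] q' q P.dual_tree_spanning[OF T']])
    show "boundary ?H c \<in> duality_iso G rv \<sigma> \<omega> x"
      unfolding \<phi>x by (rule P.H.self_mem_divisor_class[OF P.H.boundary_Div0[OF orient' c(1)]])
    show "lookup (boundary ?H c) f = outflow ?H (D.reversal_flow q' q (dual_tree G T) (dual_tree G T')) f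
        + laplacian ?H (\<lambda>_. 0) f" for f
      unfolding bH P.reversal_flow_dual[OF T T'] w_def by (simp add: laplacian_def)
  qed
  then show ?thesis using \<open>rotor_action G rv \<sigma> q x T = T'\<close> by simp
qed

end
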